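(* Let $G=(V,E)$ be a finite (not necessarily planar) graph, $\beta>0$, and let $a,b\in V$ be distinct. Then $$\langle\sigma_a^2\bar\sigma_b^2\rangle_{G,\beta}=\mathbf E_{G,\beta}\Big[\frac{m_{a,b}}{m_{a,b}+1}\Big],$$ and in particular $$\tfrac12\,\mathbf P_{G,\beta}(m_{a,b}>0)\le\langle\sigma_a^2\bar\sigma_b^2\rangle_{G,\beta}\le\mathbf P_{G,\beta}(m_{a,b}>0).$$
   Context: XY model: for a finite graph $G=(V,E)$ and $\beta>0$, $\langle\cdot\rangle_{G,\beta}$ is the expectation with respect to the probability measure on $\mathbb S^V$ ($\mathbb S$ the complex unit circle) $d\mu_{G,\beta}(\sigma)\propto\exp\big(\tfrac12\beta\sum_{vv'\in E}(\sigma_v\bar\sigma_{v'}+\bar\sigma_v\sigma_{v'})\big)\prod_v d\sigma_v$, with $d\sigma_v$ the uniform probability measure on $\mathbb S$. Loop configurations: a submultigraph $\mathcal M$ of $G$ is obtained by taking $\mathcal M_e\in\{0,1,2,\dots\}$ (labelled, distinguishable) parallel copies of each edge $e\in E$. A loop configuration on $\mathcal M$ is a collection of unrooted directed loops on $\mathcal M$ such that every edge of $\mathcal M$ is traversed exactly once by a loop. Equivalently, it consists of an orientation of every edge of $\mathcal M$ with equally many incoming and outgoing edges at each vertex, together with, at each vertex, a perfect matching of incoming edges with outgoing edges. Let $\mathcal L_0$ be the set of all loop configurations on all submultigraphs of $G$. The weight of $\omega\in\mathcal L_0$ with underlying multigraph $\mathcal M$ is $$\lambda_\beta(\omega)=\prod_{v\in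 V}\frac{1}{(\deg_{\mathcal M}(v)/2)!}\prod_{e\in E}\frac1{\mathcal M_e!}\Big(\frac\beta2\Big)^{\mathcal M_e},$$ and $\mathbf P_{G,\beta}$ (with expectation $\mathbf E_{G,\beta}$) is the probability measure on $\mathcal L_0$ proportional to $\lambda_\beta$. For $\omega\in\mathcal L_0$, $m_{a,b}(\omega)$ is the number of pieces of loops of $\omega$ (directed subpaths of loops) that go from $a$ to $b$ and do not visit $a$ or $b$ except at their start and end vertex. *)

theory Defs
  imports "HOL-Probability.Probability"
begin

definition finite_graph :: "'a set \<Rightarrow> 'a set set \<Rightarrow> bool" where
  "finite_graph V E \<longleftrightarrow> finite V \<and> (\<forall>e\<in>E. e \<subseteq> V \<and> card e = 2)"

text \<open>The two ways of orienting an edge, as pairs (tail, head).\<close>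

definition orientations :: "'a set \<Rightarrow> ('a \<times> 'a) set" where
  "orientations e = {(v, w). e = {v, w}}"

definition normalized :: "'b measure \<Rightarrow> 'b measure" where
  "normalized M = density M (\<lambda>_. 1 / emeasure M (space M))"

definition circle_measure :: "complex measure" where
  "circle_measure =
     distr (uniform_measure lborel {0..<2 * pi}) (restrict_space borel (sphere 0 1)) cis"

text \<open>The inner sum over the two orientations of an edge \<open>{v, w}\<close> is
  \<open>\<sigma> v * cnj (\<sigma> w) + cnj (\<sigma> v) * \<sigma> w\<close>. This is a real number, so taking
  real parts termwise only serves to obtain type \<^typ>\<open>real\<close>.\<close>

definition xy_density :: "'a set set \<Rightarrow> real \<Rightarrow> ('a \<Rightarrow> complex) \<Rightarrow> real" where
  "xy_density E \<beta> \<sigma> =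
     exp (1 / 2 * \<beta> * (\<Sum>e\<in>E. \<Sum>(v, w)\<in>orientations e. Re (\<sigma> v * cnj (\<sigma> w))))"

definition xy_measure :: "'a set \<Rightarrow> 'a set set \<Rightarrow> real \<Rightarrow> ('a \<Rightarrow> complex) measure" where
  "xy_measure V E \<beta> =
     normalized (density (PiM V (\<lambda>_. circle_measure)) (\<lambda>\<sigma>. ennreal (xy_density E \<beta> \<sigma>)))"

definition xy_expectation ::
  "'a set \<Rightarrow> 'a set set \<Rightarrow> real \<Rightarrow> (('a \<Rightarrow> complex) \<Rightarrow> complex) \<Rightarrow> complex" where
  "xy_expectation V E \<beta> f = integral\<^sup>L (xy_measure V E \<beta>) f"

text \<open>The pair \<open>(e, i)\<close> with \<open>i < mult \<omega> e\<close> is the \<open>i\<close>-th labelled copy of the edge \<open>e\<close>.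
  The field \<open>orient\<close> gives the (tail, head) of each copy, and \<open>succ\<close> sends a copy to the one
  traversed next by its loop, i.e. it matches the copies entering a vertex with those leaving it.\<close>

type_synonym 'a edge_copy = "'a set \<times> nat"

record 'a loop_config =
  mult :: "'a set \<Rightarrow> nat"
  orient :: "'a edge_copy \<Rightarrow> 'a \<times> 'a"
  succ :: "'a edge_copy \<Rightarrow> 'a edge_copy"

definition copies :: "'a set set \<Rightarrow> 'a loop_config \<Rightarrow> 'a edge_copy set" where
  "copies E \<omega> = {(e, i). e \<in> E \<and> i < mult \<omega> e}"

definition tail :: "'a loop_config \<Rightarrow> 'a edge_copy \<Rightarrow> 'a" where
  "tail \<omega> c = fst (orient \<omega> c)"

definition head :: "'a loop_config \<Rightarrow> 'a edge_copy \<Rightarrow> 'a" where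
  "head \<omega> c = snd (orient \<omega> c)"

definition incoming :: "'a set set \<Rightarrow> 'a loop_config \<Rightarrow> 'a \<Rightarrow> 'a edge_copy set" where
  "incoming E \<omega> v = {c \<in> copies E \<omega>. head \<omega> c = v}"

definition outgoing :: "'a set set \<Rightarrow> 'a loop_config \<Rightarrow> 'a \<Rightarrow> 'a edge_copy set" where
  "outgoing E \<omega> v = {c \<in> copies E \<omega>. tail \<omega> c = v}"

text \<open>Fixing the values of the three fields outside \<open>E\<close>, respectively outside the set of
  copies, makes each loop configuration correspond to exactly one record.\<close>

definition loop_configs :: "'a set \<Rightarrow> 'a set set \<Rightarrow> 'a loop_config set" where
  "loop_configs V E = {\<omega>.
     (\<forall>e. e \<notin> E \<longrightarrow> mult \<omega> e = 0) \<and>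
     orient \<omega> \<in> (\<Pi>\<^sub>E c\<in>copies E \<omega>. orientations (fst c)) \<and>
     (\<forall>v\<in>V. card (incoming E \<omega> v) = card (outgoing E \<omega> v)) \<and>
     succ \<omega> \<in> extensional (copies E \<omega>) \<and>
     (\<forall>v\<in>V. bij_betw (succ \<omega>) (incoming E \<omega> v) (outgoing E \<omega> v))}"

definition degree :: "'a set set \<Rightarrow> 'a loop_config \<Rightarrow> 'a \<Rightarrow> nat" where
  "degree E \<omega> v = (\<Sum>e\<in>{e\<in>E. v \<in> e}. mult \<omega> e)"

text \<open>Degrees are even for loop configurations, so the division by 2 is exact.\<close>

definition loop_weight :: "'a set \<Rightarrow> 'a set set \<Rightarrow> real \<Rightarrow> 'a loop_config \<Rightarrow> real" where
  "loop_weight V E \<beta> \<omega> =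
     (\<Prod>v\<in>V. 1 / fact (degree E \<omega> v div 2)) *
     (\<Prod>e\<in>E. 1 / fact (mult \<omega> e) * (\<beta> / 2) ^ mult \<omega> e)"

definition loop_measure :: "'a set \<Rightarrow> 'a set set \<Rightarrow> real \<Rightarrow> 'a loop_config measure" where
  "loop_measure V E \<beta> =
     normalized (density (count_space (loop_configs V E)) (\<lambda>\<omega>. ennreal (loop_weight V E \<beta> \<omega>)))"

text \<open>A piece of a loop is the list of edge copies it successively traverses; the vertices it
  visits strictly between its start and its end are the heads of all copies but the last.\<close>

definition pieces ::
  "'a set set \<Rightarrow> 'a \<Rightarrow> 'a \<Rightarrow> 'a loop_config \<Rightarrow> 'a edge_copy list set" where
  "pieces E a b \<omega> = {cs. cs \<noteq> [] \<and> set cs \<subseteq> copies E \<omega> \<and>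
     (\<forall>i. Suc i < length cs \<longrightarrow> cs ! Suc i = succ \<omega> (cs ! i)) \<and>
     tail \<omega> (hd cs) = a \<and> head \<omega> (last cs) = b \<and>
     (\<forall>c\<in>set (butlast cs). head \<omega> c \<noteq> a \<and> head \<omega> c \<noteq> b)}"

definition num_pieces :: "'a set set \<Rightarrow> 'a \<Rightarrow> 'a \<Rightarrow> 'a loop_config \<Rightarrow> nat" where
  "num_pieces E a b \<omega> = card (pieces E a b \<omega>)"

end

theory Submission imports Defs begin

text \<open>
  Fix the edge multiplicities, orient every edge copy, and match incoming with outgoing copies at
  all vertices except \<open>a\<close> and \<open>b\<close>. This cuts the configuration into closed loops avoiding
  \<open>a\<close>, \<open>b\<close> and paths between these two vertices; say \<open>k\<close> of them go from \<open>a\<close> to \<open>b\<close> and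
  \<open>l\<close> from \<open>b\<close> to \<open>a\<close>. The numbers of copies leaving and entering \<open>a\<close> differ by \<open>k - l\<close>, so
  the flow is balanced at \<open>a\<close> and \<open>b\<close> iff \<open>k = l\<close>, and then \<open>m = k\<close> irrespective of the
  matchings at \<open>a\<close> and \<open>b\<close>. Reversing one marked path from \<open>a\<close> to \<open>b\<close> is a bijection
  from balanced configurations with \<open>k = l = m\<close> onto configurations with \<open>k = m - 1\<close>,
  \<open>l = m + 1\<close> and a marked path from \<open>b\<close> to \<open>a\<close>. Hence the number of unbalanced configurations
  is the sum of \<open>m / (m + 1)\<close> over the balanced ones. Expanding the exponential of the
  energy, the unbalanced ones are those surviving integration against
  \<open>\<sigma>\<^sub>a\<^sup>2 \<sigma>\<^sub>b\<^sup>-\<^sup>2\<close>, and the factors \<open>1 / (deg / 2)!\<close> in the loop weight cancel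
  the number of matchings at the vertices.
\<close>

section \<open>Reversing trails\<close>

text \<open>Only copies with head in \<open>W\<close> have a successor. With \<open>W = V\<close>
  this is the \<open>succ\<close> field of a loop configuration, while \<open>W = V - {a, b}\<close>
  cuts the loops open at the two marked vertices. Extensionality makes each such map count
  once.\<close>

definition matchings :: "'c set \<Rightarrow> 'v set \<Rightarrow> ('c \<Rightarrow> 'v \<times> 'v) \<Rightarrow> ('c \<Rightarrow> 'c) set" where
  "matchings C W o' = {s \<in> extensional {c \<in> C. snd (o' c) \<in> W}.
     \<forall>v\<in>W. bij_betw s {c \<in> C. snd (o' c) = v} {c \<in> C. fst (o' c) = v}}"

lemma matchingsD:
  assumes "s \<in> matchings C W o'" "c \<in> C" "snd (o' c) \<in> W"
  shows "s c \<in> C" "fst (o' (s c)) = snd (o' c)"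
  using assms bij_betwE[of s "{c' \<in> C. snd (o' c') = snd (o' c)}"] unfolding matchings_def by auto

text \<open>A copy and its successor meet at a vertex, so the vertexwise bijections have disjoint
  ranges and glue together.\<close>

lemma matchings_bij_betw:
  assumes "s \<in> matchings C W o'"
  shows "bij_betw s {c \<in> C. snd (o' c) \<in> W} {c \<in> C. fst (o' c) \<in> W}"
proof -
  have eq: "bij_betw s {c \<in> C. snd (o' c) = v} {c \<in> C. fst (o' c) = v}" if "v \<in> W" for v
    using assms that unfolding matchings_def by auto
  have "inj_on s {c \<in> C. snd (o' c) \<in> W}"
  proof (rule inj_onI)
    fix c d assume *: "c \<in> {c \<in> C. snd (o' c) \<in> W}" "d \<in> {c \<in> C. snd (o' c) \<in> W}" "s c = s d"
    then have "snd (o' c) = snd (o' d)"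
      using matchingsD(2)[OF assms] by (metis (mono_tags, lifting) mem_Collect_eq)
    then show "c = d"
      using eq[of "snd (o' c)"] * unfolding bij_betw_def inj_on_def by auto
  qed
  moreover have "s ` {c \<in> C. snd (o' c) \<in> W} = {c \<in> C. fst (o' c) \<in> W}"
  proof
    show "s ` {c \<in> C. snd (o' c) \<in> W} \<subseteq> {c \<in> C. fst (o' c) \<in> W}"
      using matchingsD[OF assms] by auto
    show "{c \<in> C. fst (o' c) \<in> W} \<subseteq> s ` {c \<in> C. snd (o' c) \<in> W}"
    proof
      fix d assume d: "d \<in> {c \<in> C. fst (o' c) \<in> W}"
      then have "d \<in> s ` {c \<in> C. snd (o' c) = fst (o' d)}"
        using bij_betw_imp_surj_on[OF eq[of "fst (o' d)"]] by auto
      then show "d \<in> s ` {c \<in> C. snd (o' c) \<in> W}" using d by auto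
    qed
  qed
  ultimately show ?thesis by (simp add: bij_betw_def)
qed

text \<open>Converse of the gluing, used to verify that a reversed successor map is again a
  matching.\<close>

lemma matchingsI:
  assumes "s \<in> extensional {c \<in> C. snd (o' c) \<in> W}"
    and "bij_betw s {c \<in> C. snd (o' c) \<in> W} {c \<in> C. fst (o' c) \<in> W}"
    and "\<And>c. c \<in> C \<Longrightarrow> snd (o' c) \<in> W \<Longrightarrow> fst (o' (s c)) = snd (o' c)"
  shows "s \<in> matchings C W o'"
proof -
  have "bij_betw s {c \<in> C. snd (o' c) = v} {c \<in> C. fst (o' c) = v}" if v: "v \<in> W" for v
  proof (rule bij_betw_subset[OF assms(2)])
    show "{c \<in> C. snd (o' c) = v} \<subseteq> {c \<in> C. snd (o' c) \<in> W}" using v by auto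
    show "s ` {c \<in> C. snd (o' c) = v} = {c \<in> C. fst (o' c) = v}"
    proof
      show "s ` {c \<in> C. snd (o' c) = v} \<subseteq> {c \<in> C. fst (o' c) = v}"
        using assms(3) v bij_betwE[OF assms(2)] by auto
      show "{c \<in> C. fst (o' c) = v} \<subseteq> s ` {c \<in> C. snd (o' c) = v}"
      proof
        fix d assume d: "d \<in> {c \<in> C. fst (o' c) = v}"
        then have "d \<in> s ` {c \<in> C. snd (o' c) \<in> W}"
          using bij_betw_imp_surj_on[OF assms(2)] v by auto
        then obtain c where "c \<in> C" "snd (o' c) \<in> W" "d = s c" by auto
        then show "d \<in> s ` {c \<in> C. snd (o' c) = v}" using assms(3) d by auto
      qed
    qed
  qed
  then show ?thesis using assms(1) by (simp add: matchings_def)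
qed

text \<open>For \<open>x\<close> and \<open>y\<close> outside \<open>W\<close> these are the maximal
  chains of \<open>s\<close>: the first copy has no predecessor and the last one no
  successor.\<close>

definition trails ::
  "'c set \<Rightarrow> 'v set \<Rightarrow> ('c \<Rightarrow> 'v \<times> 'v) \<Rightarrow> ('c \<Rightarrow> 'c) \<Rightarrow> 'v \<Rightarrow> 'v \<Rightarrow> 'c list set" where
  "trails C W o' s x y = {cs. cs \<noteq> [] \<and> set cs \<subseteq> C \<and>
     (\<forall>i. Suc i < length cs \<longrightarrow> cs ! Suc i = s (cs ! i)) \<and>
     fst (o' (hd cs)) = x \<and> snd (o' (last cs)) = y \<and>
     (\<forall>i. Suc i < length cs \<longrightarrow> snd (o' (cs ! i)) \<in> W)}"

text \<open>The first copy determines the chain, and the chain stops as soon as it leaves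
  \<open>W\<close>; a proper extension would have an interior head outside \<open>W\<close>.\<close>

lemma trails_hd_inj:
  assumes "cs \<in> trails C W o' s x y" "ds \<in> trails C W o' s x' y'" "y \<notin> W" "y' \<notin> W" "hd cs = hd ds"
  shows "cs = ds"
proof -
  have *: "cs ! i = ds ! i"
    if "i < length cs" "i < length ds" for i
    using that
  proof (induction i)
    case 0
    then show ?case using assms by (simp add: hd_conv_nth flip: length_greater_0_conv)
  next
    case (Suc i)
    then show ?case using assms by (simp add: trails_def)
  qed
  have "\<not> length cs < length ds"
  proof
    assume l: "length cs < length ds"
    have "last cs = ds ! (length cs - 1)"
      using * assms(1) l by (simp add: trails_def last_conv_nth)
    moreover have "Suc (length cs - 1) < length ds" using l assms(1) by (auto simp: trails_def)
    ultimately show False using assms by (auto simp: trails_def)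
  qed
  moreover have "\<not> length ds < length cs"
  proof
    assume l: "length ds < length cs"
    have "last ds = cs ! (length ds - 1)"
      using * assms(2) l by (simp add: trails_def last_conv_nth)
    moreover have "Suc (length ds - 1) < length cs" using l assms(2) by (auto simp: trails_def)
    ultimately show False using assms by (auto simp: trails_def)
  qed
  ultimately show ?thesis using * by (simp add: list_eq_iff_nth_eq)
qed

text \<open>A succ-closed set is a union of trails and closed loops, so all of it can be reversed at once.\<close>

definition succ_closed :: "'c set \<Rightarrow> 'v set \<Rightarrow> ('c \<Rightarrow> 'v \<times> 'v) \<Rightarrow> ('c \<Rightarrow> 'c) \<Rightarrow> 'c set \<Rightarrow> bool" where
  "succ_closed C W o' s S \<longleftrightarrow>
     S \<subseteq> C \<and> (\<forall>c\<in>C. snd (o' c) \<in> W \<longrightarrow> (s c \<in> S \<longleftrightarrow> c \<in> S))"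

definition flip_orient :: "'c set \<Rightarrow> ('c \<Rightarrow> 'v \<times> 'v) \<Rightarrow> 'c \<Rightarrow> 'v \<times> 'v" where
  "flip_orient S o' c = (if c \<in> S then prod.swap (o' c) else o' c)"

text \<open>After the reversal, \<open>c\<close> is followed by the copy that preceded it. A
  reversed copy whose old tail lies outside \<open>W\<close> becomes the end of a trail; the value
  \<open>undefined\<close> keeps the map extensional.\<close>

definition flip_succ :: "'v set \<Rightarrow> ('c \<Rightarrow> 'v \<times> 'v) \<Rightarrow> 'c set \<Rightarrow> ('c \<Rightarrow> 'c) \<Rightarrow> 'c \<Rightarrow> 'c" where
  "flip_succ W o' S s c =
     (if c \<in> S then if fst (o' c) \<in> W then inv_into {c \<in> S. snd (o' c) \<in> W} s c else undefined
      else s c)"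

lemma flip_orient_flip_orient [simp]: "flip_orient S (flip_orient S o') = o'"
  by (auto simp: flip_orient_def)

text \<open>Closedness means that \<open>s\<close> crosses the border of \<open>S\<close> in neither
  direction, so the global bijection splits into one on \<open>S\<close> and one on its
  complement.\<close>

lemma succ_closed_bij_betw:
  assumes "s \<in> matchings C W o'" "succ_closed C W o' s S"
  shows "bij_betw s {c \<in> S. snd (o' c) \<in> W} {c \<in> S. fst (o' c) \<in> W}"
    and "bij_betw s {c \<in> C - S. snd (o' c) \<in> W} {c \<in> C - S. fst (o' c) \<in> W}"
proof -
  note b = matchings_bij_betw[OF assms(1)]
  have S: "S \<subseteq> C" and cl: "\<And>c. c \<in> C \<Longrightarrow> snd (o' c) \<in> W \<Longrightarrow> s c \<in> S \<longleftrightarrow> c \<in> S"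
    using assms(2) by (auto simp: succ_closed_def)
  have im: "s ` {c \<in> C. snd (o' c) \<in> W} = {c \<in> C. fst (o' c) \<in> W}"
    using b by (simp add: bij_betw_def)
  have ex: "\<exists>c\<in>C. snd (o' c) \<in> W \<and> d = s c" if "d \<in> C" "fst (o' d) \<in> W" for d
    using im that by (auto simp: set_eq_iff image_iff)
  show "bij_betw s {c \<in> S. snd (o' c) \<in> W} {c \<in> S. fst (o' c) \<in> W}"
  proof (rule bij_betw_subset[OF b])
    show "s ` {c \<in> S. snd (o' c) \<in> W} = {c \<in> S. fst (o' c) \<in> W}"
    proof (intro equalityI subsetI)
      fix d assume "d \<in> s ` {c \<in> S. snd (o' c) \<in> W}"
      then show "d \<in> {c \<in> S. fst (o' c) \<in> W}" using S cl matchingsD[OF assms(1)] by auto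
    next
      fix d assume d: "d \<in> {c \<in> S. fst (o' c) \<in> W}"
      then obtain c where "c \<in> C" "snd (o' c) \<in> W" "d = s c" using ex S by blast
      then show "d \<in> s ` {c \<in> S. snd (o' c) \<in> W}" using d cl by auto
    qed
  qed (use S in auto)
  show "bij_betw s {c \<in> C - S. snd (o' c) \<in> W} {c \<in> C - S. fst (o' c) \<in> W}"
  proof (rule bij_betw_subset[OF b])
    show "s ` {c \<in> C - S. snd (o' c) \<in> W} = {c \<in> C - S. fst (o' c) \<in> W}"
    proof (intro equalityI subsetI)
      fix d assume "d \<in> s ` {c \<in> C - S. snd (o' c) \<in> W}"
      then show "d \<in> {c \<in> C - S. fst (o' c) \<in> W}" using cl matchingsD[OF assms(1)] by auto
    next
      fix d assume d: "d \<in> {c \<in> C - S. fst (o' c) \<in> W}"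
      then obtain c where "c \<in> C" "snd (o' c) \<in> W" "d = s c" using ex by blast
      then show "d \<in> s ` {c \<in> C - S. snd (o' c) \<in> W}" using d cl by auto
    qed
  qed auto
qed

lemma flip_succ_flipped:
  assumes "s \<in> matchings C W o'" "succ_closed C W o' s S" "c \<in> S" "snd (o' c) \<in> W"
  shows "flip_succ W o' S s (s c) = c"
proof -
  note b = succ_closed_bij_betw(1)[OF assms(1,2)]
  have "s c \<in> S" "fst (o' (s c)) \<in> W" using bij_betwE[OF b] assms by auto
  then show ?thesis
    using b assms(3,4) by (simp add: flip_succ_def bij_betw_def)
qed

text \<open>The new map is the inverse of \<open>s\<close> on \<open>S\<close> and \<open>s\<close>
  itself elsewhere, and closedness keeps the two ranges apart. Inverting twice restores
  \<open>s\<close>, so reversal is an involution; this is what later makes it a bijection.\<close>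

lemma flip_matching:
  assumes s: "s \<in> matchings C W o'" and cl: "succ_closed C W o' s S"
  shows "flip_succ W o' S s \<in> matchings C W (flip_orient S o')"
    and "succ_closed C W (flip_orient S o') (flip_succ W o' S s) S"
    and "flip_succ W (flip_orient S o') S (flip_succ W o' S s) = s"
proof -
  define t where "t = flip_succ W o' S s"
  define o2 where "o2 = flip_orient S o'"
  note b = succ_closed_bij_betw[OF s cl]
  have S: "S \<subseteq> C" using cl by (auto simp: succ_closed_def)
  have ext: "s \<in> extensional {c \<in> C. snd (o' c) \<in> W}" using s by (simp add: matchings_def)
  \<comment> \<open>The flip exchanges heads and tails on \<open>S\<close> only, so domain and range
    of the new map are disjoint unions of a part in \<open>S\<close> and a part outside.\<close>
  have dom: "{c \<in> C. snd (o2 c) \<in> W} = {c \<in> S. fst (o' c) \<in> W} \<union> {c \<in> C - S. snd (o' c) \<in> W}"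
    and ran: "{c \<in> C. fst (o2 c) \<in> W} = {c \<in> S. snd (o' c) \<in> W} \<union> {c \<in> C - S. fst (o' c) \<in> W}"
    using S by (auto simp: o2_def flip_orient_def split: if_splits)
  have b1: "bij_betw t {c \<in> S. fst (o' c) \<in> W} {c \<in> S. snd (o' c) \<in> W}"
    using bij_betw_inv_into[OF b(1)]
    by (rule bij_betw_cong[THEN iffD1, rotated]) (auto simp: t_def flip_succ_def)
  have b2: "bij_betw t {c \<in> C - S. snd (o' c) \<in> W} {c \<in> C - S. fst (o' c) \<in> W}"
    using b(2) by (rule bij_betw_cong[THEN iffD1, rotated]) (auto simp: t_def flip_succ_def)
  have bt: "bij_betw t {c \<in> C. snd (o2 c) \<in> W} {c \<in> C. fst (o2 c) \<in> W}"
    unfolding dom ran by (rule bij_betw_combine[OF b1 b2]) auto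
  have ts: "s (t c) = c" if "c \<in> S" "fst (o' c) \<in> W" for c
    using that bij_betw_inv_into_right[OF b(1)] by (auto simp: t_def flip_succ_def)
  show 1: "t \<in> matchings C W o2"
  proof (rule matchingsI[OF _ bt])
    show "t \<in> extensional {c \<in> C. snd (o2 c) \<in> W}"
      using ext by (auto simp: extensional_def dom t_def flip_succ_def)
    fix c assume c: "c \<in> C" "snd (o2 c) \<in> W"
    show "fst (o2 (t c)) = snd (o2 c)"
    proof (cases "c \<in> S")
      case True
      then have *: "fst (o' c) \<in> W" using c by (simp add: o2_def flip_orient_def)
      then have "t c \<in> S" "snd (o' (t c)) \<in> W" using bij_betwE[OF b1] True by auto
      then have "fst (o' (s (t c))) = snd (o' (t c))" using matchingsD(2)[OF s] S by auto
      then show ?thesis using True \<open>t c \<in> S\<close> ts[OF True *] by (simp add: o2_def flip_orient_def)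
    next
      case False
      then have *: "snd (o' c) \<in> W" using c by (simp add: o2_def flip_orient_def)
      then have "t c \<in> C - S" "t c = s c" using bij_betwE[OF b2] False c
        by (auto simp: t_def flip_succ_def)
      then show ?thesis using False matchingsD(2)[OF s c(1) *] by (simp add: o2_def flip_orient_def)
    qed
  qed
  show 2: "succ_closed C W o2 t S"
    unfolding succ_closed_def
  proof (intro conjI ballI impI S)
    fix c assume c: "c \<in> C" "snd (o2 c) \<in> W"
    show "t c \<in> S \<longleftrightarrow> c \<in> S"
      using bij_betwE[OF b1] bij_betwE[OF b2] c
      by (cases "c \<in> S") (auto simp: o2_def flip_orient_def)
  qed
  show "flip_succ W o2 S t = s"
  proof
    fix c show "flip_succ W o2 S t c = s c"
    proof (cases "c \<in> S \<and> snd (o' c) \<in> W")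
      case True
      then have sc: "s c \<in> S" "fst (o' (s c)) \<in> W" using bij_betwE[OF b(1)] by auto
      \<comment> \<open>As \<open>t\<close> undoes \<open>s\<close>, the copy preceding
        \<open>c\<close> for \<open>t\<close> is \<open>s c\<close>, and the second flip sends
        \<open>c\<close> there.\<close>
      have "t (s c) = c" unfolding t_def by (rule flip_succ_flipped[OF s cl]) (use True in auto)
      moreover have "flip_succ W o2 S t (t (s c)) = s c"
        by (rule flip_succ_flipped[OF 1 2]) (use sc in \<open>auto simp: o2_def flip_orient_def\<close>)
      ultimately show ?thesis by simp
    next
      case False
      then show ?thesis using ext S
        by (auto simp: flip_succ_def o2_def flip_orient_def t_def extensional_def)
    qed
  qed
qed

lemma trails_rev:
  assumes s: "s \<in> matchings C W o'" and cl: "succ_closed C W o' s S"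
    and cs: "cs \<in> trails C W o' s x y" and sub: "set cs \<subseteq> S"
  shows "rev cs \<in> trails C W (flip_orient S o') (flip_succ W o' S s) y x"
proof -
  have ne: "cs \<noteq> []" and C: "set cs \<subseteq> C"
    and ch: "\<And>i. Suc i < length cs \<Longrightarrow> cs ! Suc i = s (cs ! i)"
    and W: "\<And>i. Suc i < length cs \<Longrightarrow> snd (o' (cs ! i)) \<in> W"
    and x: "fst (o' (hd cs)) = x" and y: "snd (o' (last cs)) = y"
    using cs by (auto simp: trails_def)
  \<comment> \<open>With \<open>j = length cs - Suc (Suc i)\<close>, positions \<open>i\<close> and
    \<open>Suc i\<close> of \<open>rev cs\<close> hold the entries \<open>Suc j\<close> and
    \<open>j\<close> of \<open>cs\<close>.\<close>
  have r: "rev cs ! Suc i = cs ! (length cs - Suc (Suc i))"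
    "rev cs ! i = cs ! Suc (length cs - Suc (Suc i))"
    "Suc (length cs - Suc (Suc i)) < length cs" if "Suc i < length cs" for i
    using that by (simp_all add: rev_nth Suc_diff_Suc)
  have mem: "cs ! i \<in> S" if "i < length cs" for i using sub that by (auto simp: subset_iff)
  have ends: "hd cs \<in> S" "last cs \<in> S" using ne sub by auto
  show ?thesis
    unfolding trails_def
  proof (intro CollectI conjI allI impI)
    show "rev cs \<noteq> []" "set (rev cs) \<subseteq> C" using ne C by auto
    show "fst (flip_orient S o' (hd (rev cs))) = y"
      using y ends ne by (simp add: flip_orient_def hd_rev)
    show "snd (flip_orient S o' (last (rev cs))) = x"
      using x ends ne by (simp add: flip_orient_def last_rev)
    fix i assume "Suc i < length (rev cs)"
    then have i: "Suc i < length cs" by simp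
    define j where "j = length cs - Suc (Suc i)"
    note r = r[OF i, folded j_def]
    show "rev cs ! Suc i = flip_succ W o' S s (rev cs ! i)"
      using flip_succ_flipped[OF s cl mem W[OF r(3)], of] ch[OF r(3)] r by simp
    have "fst (o' (cs ! Suc j)) = snd (o' (cs ! j))"
      using ch[OF r(3)] matchingsD(2)[OF s _ W[OF r(3)]] C r(3) by (auto simp: subset_iff)
    then show "snd (flip_orient S o' (rev cs ! i)) \<in> W"
      using W[OF r(3)] mem[OF r(3)] r by (simp add: flip_orient_def)
  qed
qed

lemma trails_disjoint:
  assumes cs: "cs \<in> trails C W o' s x y" and dis: "set cs \<inter> S = {}"
  shows "cs \<in> trails C W (flip_orient S o') (flip_succ W o' S s) x y"
proof -
  have "cs ! i \<notin> S" if "i < length cs" for i using dis that by (auto dest: nth_mem)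
  moreover have "hd cs \<notin> S" "last cs \<notin> S" using cs dis by (auto simp: trails_def disjoint_iff)
  ultimately show ?thesis using cs by (auto simp: trails_def flip_orient_def flip_succ_def)
qed

lemma trails_subset_or_disjoint:
  assumes cs: "cs \<in> trails C W o' s x y" and cl: "succ_closed C W o' s S"
  shows "set cs \<subseteq> S \<or> set cs \<inter> S = {}"
proof -
  have "cs ! i \<in> S \<longleftrightarrow> cs ! 0 \<in> S" if "i < length cs" for i
    using that
  proof (induction i)
    case (Suc i)
    then have "cs ! i \<in> C" "snd (o' (cs ! i)) \<in> W" "cs ! Suc i = s (cs ! i)"
      using cs by (auto simp: trails_def subset_iff)
    then show ?case using cl Suc by (auto simp: succ_closed_def)
  qed simp
  then show ?thesis by (auto simp: in_set_conv_nth)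
qed

text \<open>A copy of the trail with head in \<open>W\<close> is not the last one, so its successor
  is on the trail. A copy of the trail with tail in \<open>W\<close> is not the first one, so by
  injectivity of \<open>s\<close> its only predecessor is on the trail.\<close>

lemma trails_closed:
  assumes s: "s \<in> matchings C W o'" and cs: "cs \<in> trails C W o' s x y"
    and x: "x \<notin> W" and y: "y \<notin> W"
  shows "succ_closed C W o' s (set cs)"
proof -
  have ne: "cs \<noteq> []" and C: "set cs \<subseteq> C"
    and ch: "\<And>i. Suc i < length cs \<Longrightarrow> cs ! Suc i = s (cs ! i)"
    and W: "\<And>i. Suc i < length cs \<Longrightarrow> snd (o' (cs ! i)) \<in> W"
    and hx: "fst (o' (hd cs)) = x" and ly: "snd (o' (last cs)) = y"
    using cs by (auto simp: trails_def)
  have "s c \<in> set cs \<longleftrightarrow> c \<in> set cs" if c: "c \<in> C" "snd (o' c) \<in> W" for c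
  proof
    assume "c \<in> set cs"
    then obtain i where i: "i < length cs" "c = cs ! i" by (auto simp: in_set_conv_nth)
    have "i \<noteq> length cs - 1" using ly y c i ne by (auto simp: last_conv_nth)
    then have "Suc i < length cs" using i by simp
    then show "s c \<in> set cs" using ch i by (metis nth_mem)
  next
    assume "s c \<in> set cs"
    then obtain j where j: "j < length cs" "s c = cs ! j" by (auto simp: in_set_conv_nth)
    have "fst (o' (cs ! j)) \<in> W" using matchingsD(2)[OF s c] j c by simp
    then have "j \<noteq> 0" using hx x ne by (metis hd_conv_nth)
    then obtain i where i: "j = Suc i" by (cases j) auto
    then have "s c = s (cs ! i)" "snd (o' (cs ! i)) \<in> W" "cs ! i \<in> C"
      using ch W j C by (auto simp: subset_iff)
    then have "c = cs ! i"
      using matchings_bij_betw[OF s] c unfolding bij_betw_def inj_on_def by auto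
    then show "c \<in> set cs" using i j by simp
  qed
  then show ?thesis using C by (auto simp: succ_closed_def)
qed

text \<open>The first copy of \<open>ds\<close> starts outside \<open>W\<close>, whereas all copies
  of \<open>cs\<close> but the first start in \<open>W\<close>; so both trails have the same first
  copy.\<close>

lemma trails_subset_eq:
  assumes s: "s \<in> matchings C W o'" and cs: "cs \<in> trails C W o' s x y"
    and ds: "ds \<in> trails C W o' s x' y'" and sub: "set ds \<subseteq> set cs"
    and "x' \<notin> W" "y \<notin> W" "y' \<notin> W"
  shows "ds = cs"
proof (rule trails_hd_inj[OF ds cs])
  have "hd ds \<in> set cs" using ds sub by (auto simp: trails_def)
  then obtain i where i: "i < length cs" "hd ds = cs ! i" by (auto simp: in_set_conv_nth)
  have "i = 0"
  proof (cases i)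
    case (Suc j)
    then have "cs ! i = s (cs ! j)" "snd (o' (cs ! j)) \<in> W" "cs ! j \<in> C"
      using cs i by (auto simp: trails_def subset_iff)
    then have "fst (o' (hd ds)) \<in> W" using matchingsD(2)[OF s] i by simp
    then show ?thesis using ds assms by (auto simp: trails_def)
  qed simp
  then show "hd ds = hd cs" using i by (simp add: hd_conv_nth flip: length_greater_0_conv)
qed (use assms in auto)

section \<open>Existence and number of trails\<close>

lemma trails_hd_exists:
  assumes s: "s \<in> matchings C W o'" and fin: "finite C" and c: "c \<in> C" "fst (o' c) \<notin> W"
  shows "\<exists>y cs. y \<notin> W \<and> cs \<in> trails C W o' s (fst (o' c)) y \<and> hd cs = c"
proof -
  let ?I = "{c \<in> C. snd (o' c) \<in> W}"
  have bij: "bij_betw s ?I {c \<in> C. fst (o' c) \<in> W}" by (rule matchings_bij_betw[OF s])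
  have "\<exists>n. (s ^^ n) c \<notin> ?I"
  proof (rule ccontr)
    assume "\<nexists>n. (s ^^ n) c \<notin> ?I"
    then have I: "(s ^^ n) c \<in> ?I" for n by blast
    \<comment> \<open>\<open>c\<close> is no value of \<open>s\<close> on \<open>?I\<close>, as its
      tail lies outside \<open>W\<close>. Injectivity then makes all iterates distinct, which is
      impossible in the finite set \<open>C\<close>.\<close>
    have inj: "(s ^^ i) c \<noteq> (s ^^ (i + Suc d)) c" for i d
    proof (induction i)
      case 0
      have "fst (o' ((s ^^ Suc d) c)) \<in> W"
        using bij_betwE[OF bij] I[of d] by auto
      then show ?case using c by auto
    next
      case (Suc i)
      moreover have "inj_on s ?I" using bij by (simp add: bij_betw_def)
      ultimately have "s ((s ^^ i) c) \<noteq> s ((s ^^ (i + Suc d)) c)"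
        using I by (metis (no_types, lifting) inj_onD)
      then show ?case by simp
    qed
    have "inj (\<lambda>n. (s ^^ n) c)"
    proof (rule linorder_injI)
      fix x y :: nat assume "x < y"
      then obtain d where "y = x + Suc d" by (metis less_iff_Suc_add add_Suc_right)
      then show "(s ^^ x) c \<noteq> (s ^^ y) c" using inj by simp
    qed
    moreover have "finite (range (\<lambda>n. (s ^^ n) c))"
      using I fin by (auto intro: finite_subset[of _ C])
    ultimately show False using finite_imageD infinite_UNIV_nat by blast
  qed
  \<comment> \<open>The first iterate without a successor ends the trail.\<close>
  then obtain n where n: "(s ^^ n) c \<notin> ?I" "\<And>i. i < n \<Longrightarrow> (s ^^ i) c \<in> ?I"
    using exists_least_iff[of "\<lambda>n. (s ^^ n) c \<notin> ?I"] by auto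
  define cs where "cs = map (\<lambda>i. (s ^^ i) c) [0..<Suc n]"
  have C: "(s ^^ i) c \<in> C" if "i \<le> n" for i
  proof (cases i)
    case (Suc j)
    then show ?thesis using bij_betwE[OF bij] n(2)[of j] that by auto
  qed (use c in simp)
  have "snd (o' ((s ^^ n) c)) \<notin> W" using n(1) C[of n] by auto
  moreover have "cs \<in> trails C W o' s (fst (o' c)) (snd (o' ((s ^^ n) c)))"
  proof -
    have "hd cs = c" "last cs = (s ^^ n) c" "length cs = Suc n"
      by (simp_all add: cs_def hd_map del: upt_Suc) (simp add: last_map)
    moreover have "cs ! i = (s ^^ i) c" if "i < Suc n" for i
      using that by (simp add: cs_def del: upt_Suc)
    moreover have "set cs \<subseteq> C" using C by (auto simp: cs_def simp del: upt_Suc)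
    ultimately show ?thesis using n(2) by (auto simp: trails_def)
  qed
  moreover have "hd cs = c" by (simp add: cs_def hd_map del: upt_Suc)
  ultimately show ?thesis by blast
qed

lemma finite_trails:
  assumes "finite C" "y \<notin> W"
  shows "finite (trails C W o' s x y)"
proof (rule inj_on_finite[of hd _ C])
  show "inj_on hd (trails C W o' s x y)" using assms by (auto intro!: inj_onI trails_hd_inj)
  show "hd ` trails C W o' s x y \<subseteq> C" by (auto simp: trails_def)
qed (use assms in auto)

text \<open>Each copy leaving \<open>x\<close> starts exactly one trail, and this trail can only
  stop at \<open>a\<close> or \<open>b\<close>, because all heads lie in
  \<open>W \<union> {a, b}\<close>.\<close>

lemma card_trails_out:
  assumes s: "s \<in> matchings C W o'" and fin: "finite C"
    and ends: "\<And>c. c \<in> C \<Longrightarrow> snd (o' c) \<in> W \<union> {a, b}"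
    and ab: "a \<noteq> b" "a \<notin> W" "b \<notin> W" and x: "x \<notin> W"
  shows "card {c \<in> C. fst (o' c) = x} = card (trails C W o' s x a) + card (trails C W o' s x b)"
proof -
  let ?T = "trails C W o' s x a \<union> trails C W o' s x b"
  have "bij_betw hd ?T {c \<in> C. fst (o' c) = x}"
    unfolding bij_betw_def
  proof
    show "inj_on hd ?T" using ab by (auto intro!: inj_onI elim: trails_hd_inj)
    have "c \<in> hd ` ?T" if c: "c \<in> C" "fst (o' c) = x" for c
    proof -
      obtain y cs where y: "y \<notin> W" "cs \<in> trails C W o' s (fst (o' c)) y" "hd cs = c"
        using trails_hd_exists[OF s fin] c x by blast
      then have "last cs \<in> C" "snd (o' (last cs)) = y" by (auto simp: trails_def)
      then have "y \<in> {a, b}" using ends y(1) by blast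
      then show ?thesis using y c by auto
    qed
    then show "hd ` ?T = {c \<in> C. fst (o' c) = x}" by (auto simp: trails_def)
  qed
  then have "card {c \<in> C. fst (o' c) = x} = card ?T" by (rule bij_betw_same_card[symmetric])
  also have "\<dots> = card (trails C W o' s x a) + card (trails C W o' s x b)"
    using ab by (intro card_Un_disjoint finite_trails fin) (auto simp: trails_def)
  finally show ?thesis .
qed

text \<open>Reversing everything exchanges the two ends of trails, so that statements about last elements
  follow from those about first elements.\<close>

lemma card_trails_flip_all:
  assumes s: "s \<in> matchings C W o'"
  shows "card (trails C W (flip_orient C o') (flip_succ W o' C s) x y) = card (trails C W o' s y x)"
proof (rule bij_betw_same_card[of rev])
  have cl: "succ_closed C W o' s C" using matchingsD[OF s] by (auto simp: succ_closed_def)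
  note f = flip_matching[OF s cl]
  have 1: "rev cs \<in> trails C W (flip_orient C o') (flip_succ W o' C s) x y"
    if "cs \<in> trails C W o' s y x" for cs
    by (rule trails_rev[OF s cl that]) (use that in \<open>simp add: trails_def\<close>)
  have 2: "rev cs \<in> trails C W o' s y x"
    if "cs \<in> trails C W (flip_orient C o') (flip_succ W o' C s) x y" for cs
    using trails_rev[OF f(1,2) that] that f(3) by (simp add: trails_def)
  show "bij_betw rev (trails C W (flip_orient C o') (flip_succ W o' C s) x y) (trails C W o' s y x)"
    by (rule bij_betw_byWitness[where f' = rev]) (use 1 2 in auto)
qed

lemma card_trails_in:
  assumes s: "s \<in> matchings C W o'" and fin: "finite C"
    and ends: "\<And>c. c \<in> C \<Longrightarrow> fst (o' c) \<in> W \<union> {a, b}"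
    and ab: "a \<noteq> b" "a \<notin> W" "b \<notin> W" and x: "x \<notin> W"
  shows "card {c \<in> C. snd (o' c) = x} = card (trails C W o' s a x) + card (trails C W o' s b x)"
proof -
  have cl: "succ_closed C W o' s C" using matchingsD[OF s] by (auto simp: succ_closed_def)
  have "{c \<in> C. snd (o' c) = x} = {c \<in> C. fst (flip_orient C o' c) = x}"
    by (auto simp: flip_orient_def)
  also have "card \<dots> = card (trails C W o' s a x) + card (trails C W o' s b x)"
    using card_trails_out[OF flip_matching(1)[OF s cl] fin _ ab x] ends
    by (simp add: card_trails_flip_all[OF s] flip_orient_def)
  finally show ?thesis .
qed

text \<open>Every trail other than \<open>p\<close> is disjoint from \<open>p\<close> and survives
  unchanged, while \<open>p\<close> becomes \<open>rev p\<close>. The last claim ensures that the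
  number of trails from \<open>b\<close> to \<open>a\<close> really grows by one.\<close>

lemma trails_flip:
  assumes s: "s \<in> matchings C W o'" and p: "p \<in> trails C W o' s a b"
    and ab: "a \<noteq> b" "a \<notin> W" "b \<notin> W"
  defines "o2 \<equiv> flip_orient (set p) o'" and "t \<equiv> flip_succ W o' (set p) s"
  shows "trails C W o2 t b a = insert (rev p) (trails C W o' s b a)"
    and "trails C W o2 t a b = trails C W o' s a b - {p}"
    and "rev p \<notin> trails C W o' s b a"
proof -
  have cl: "succ_closed C W o' s (set p)" by (rule trails_closed[OF s p ab(2,3)])
  note f = flip_matching[OF s cl, folded o2_def t_def]
  have ne: "set p \<noteq> {}" using p by (auto simp: trails_def)
  have oo: "flip_orient (set p) o2 = o'" by (simp add: o2_def)
  have fwd: "q \<in> trails C W o2 t x y"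
    if "q \<in> trails C W o' s x y" "x \<notin> W" "y \<notin> W" "q \<noteq> p" for q x y
  proof -
    have "\<not> set q \<subseteq> set p" using trails_subset_eq[OF s p that(1)] that ab by blast
    then have "set q \<inter> set p = {}" using trails_subset_or_disjoint[OF that(1) cl] by blast
    then show ?thesis unfolding o2_def t_def by (rule trails_disjoint[OF that(1)])
  qed
  \<comment> \<open>A trail of the reversed configuration either lies on \<open>p\<close>, and
    flipping back identifies it as \<open>rev p\<close>, or avoids \<open>p\<close> and is an old
    trail.\<close>
  have bwd: "(q \<in> trails C W o' s x y \<and> q \<noteq> p) \<or> (q = rev p \<and> x = b \<and> y = a)"
    if q: "q \<in> trails C W o2 t x y" and xy: "x \<notin> W" "y \<notin> W" for q x y
  proof (cases "set q \<subseteq> set p")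
    case True
    have "rev q \<in> trails C W o' s y x"
      using trails_rev[OF f(1,2) q True] f(3) oo by simp
    moreover from this have "rev q = p"
      by (rule trails_subset_eq[OF s p]) (use True xy ab in auto)
    ultimately show ?thesis using p by (auto simp: trails_def)
  next
    case False
    then have d: "set q \<inter> set p = {}" using trails_subset_or_disjoint[OF q f(2)] by blast
    show ?thesis using trails_disjoint[OF q d] oo f(3) d ne by auto
  qed
  have rp: "rev p \<in> trails C W o2 t b a"
    unfolding o2_def t_def by (rule trails_rev[OF s cl p]) simp
  show "rev p \<notin> trails C W o' s b a"
  proof
    assume "rev p \<in> trails C W o' s b a"
    moreover from this have "rev p = p" by (rule trails_subset_eq[OF s p]) (use ab in auto)
    ultimately show False using p ab by (auto simp: trails_def)
  qed
  have "p \<notin> trails C W o' s b a" using p ab by (auto simp: trails_def)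
  then show "trails C W o2 t b a = insert (rev p) (trails C W o' s b a)"
    using fwd[of _ b a] bwd[of _ b a] rp ab by blast
  show "trails C W o2 t a b = trails C W o' s a b - {p}"
    using fwd[of _ a b] bwd[of _ a b] ab by blast
qed

section \<open>Counting matchings\<close>

abbreviation indeg :: "'c set \<Rightarrow> ('c \<Rightarrow> 'v \<times> 'v) \<Rightarrow> 'v \<Rightarrow> nat" where
  "indeg C o' v \<equiv> card {c \<in> C. snd (o' c) = v}"

abbreviation outdeg :: "'c set \<Rightarrow> ('c \<Rightarrow> 'v \<times> 'v) \<Rightarrow> 'v \<Rightarrow> nat" where
  "outdeg C o' v \<equiv> card {c \<in> C. fst (o' c) = v}"

lemma finite_matchings:
  assumes "finite C"
  shows "finite (matchings C W o')"
proof (rule finite_subset)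
  show "matchings C W o' \<subseteq> {c \<in> C. snd (o' c) \<in> W} \<rightarrow>\<^sub>E C"
    
  proof
    fix s assume s: "s \<in> matchings C W o'"
    then show "s \<in> {c \<in> C. snd (o' c) \<in> W} \<rightarrow>\<^sub>E C"
      using matchingsD(1)[OF s] by (simp add: PiE_iff matchings_def)
  qed
qed (use assms in \<open>simp add: finite_PiE\<close>)

lemma matchings_balanced:
  assumes "s \<in> matchings C W o'" "v \<in> W"
  shows "indeg C o' v = outdeg C o' v"
  using assms bij_betw_same_card unfolding matchings_def by blast

text \<open>Both sides count pairs of a configuration and a marked trail, with weight \<open>1 / (k + 1)\<close> on the
  left and \<open>1 / l\<close> on the right; reversing the marked trail turns \<open>k = l\<close> into \<open>l = k + 2\<close>
  with the new \<open>l\<close> equal to the old \<open>k + 1\<close>.\<close>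

lemma sum_trails_weight_eq_card:
  fixes \<Omega> :: "('c \<Rightarrow> 'v \<times> 'v) set"
  assumes fin: "finite C" "finite \<Omega>"
    and flip: "\<And>o' S. o' \<in> \<Omega> \<Longrightarrow> S \<subseteq> C \<Longrightarrow> flip_orient S o' \<in> \<Omega>"
    and ends: "\<And>o' c. o' \<in> \<Omega> \<Longrightarrow> c \<in> C \<Longrightarrow>
      fst (o' c) \<in> W \<union> {a, b} \<and> snd (o' c) \<in> W \<union> {a, b}"
    and ab: "a \<noteq> b" "a \<notin> W" "b \<notin> W"
  shows "(\<Sum>o' | o' \<in> \<Omega> \<and> indeg C o' a = outdeg C o' a \<and> indeg C o' b = outdeg C o' b.
      \<Sum>s\<in>matchings C W o'.
        real (card (trails C W o' s a b)) / (real (card (trails C W o' s a b)) + 1)) =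
    (\<Sum>o' | o' \<in> \<Omega> \<and> indeg C o' a = outdeg C o' a + 2 \<and> outdeg C o' b = indeg C o' b + 2.
      real (card (matchings C W o')))"
proof -
  define X where "X = (SIGMA o':\<Omega>. matchings C W o')"
  define k where "k = (\<lambda>(o', s). card (trails C W o' s a b))"
  define l where "l = (\<lambda>(o', s). card (trails C W o' s b a))"
  \<comment> \<open>By \<open>deg\<close> below, \<open>X0\<close> consists of the pairs balanced at
    \<open>a\<close> and \<open>b\<close>, and \<open>X2\<close> of those with a surplus of two
    copies entering \<open>a\<close> and of two leaving \<open>b\<close>.\<close>
  define X0 where "X0 = {x \<in> X. k x = l x}"
  define X2 where "X2 = {x \<in> X. l x = k x + 2}"
  have finX: "finite X" unfolding X_def using fin finite_matchings by blast
  \<comment> \<open>Trails from \<open>a\<close> to \<open>a\<close> or from \<open>b\<close> to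
    \<open>b\<close> count once in each degree and cancel in the difference.\<close>
  have deg: "outdeg C o' a + l (o', s) = indeg C o' a + k (o', s)"
    "outdeg C o' b + k (o', s) = indeg C o' b + l (o', s)" if "(o', s) \<in> X" for o' s
  proof -
    have o': "o' \<in> \<Omega>" and s: "s \<in> matchings C W o'" using that by (auto simp: X_def)
    have 1: "outdeg C o' x = card (trails C W o' s x a) + card (trails C W o' s x b)"
      "indeg C o' x = card (trails C W o' s a x) + card (trails C W o' s b x)" if "x \<notin> W" for x
      using card_trails_out[OF s fin(1) _ ab that] card_trails_in[OF s fin(1) _ ab that] ends[OF o']
      by blast+
    show "outdeg C o' a + l (o', s) = indeg C o' a + k (o', s)"
      "outdeg C o' b + k (o', s) = indeg C o' b + l (o', s)"
      using 1[OF ab(2)] 1[OF ab(3)] by (simp_all add: k_def l_def)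
  qed
  have fT: "finite (trails C W o' s x a)" "finite (trails C W o' s x b)" for o' s x
    by (rule finite_trails[OF fin(1)], rule ab)+
  \<comment> \<open>Reversal of the marked trail. The same map serves both directions of the
    bijection, being its own inverse.\<close>
  let ?f = "\<lambda>((o', s), p). ((flip_orient (set p) o', flip_succ W o' (set p) s), rev p)"
  have f: "?f z \<in> (SIGMA x:X2. trails C W (fst x) (snd x) b a) \<and> ?f (?f z) = z \<and>
      l (fst (?f z)) = k (fst z) + 1"
    if z: "z \<in> (SIGMA x:X0. trails C W (fst x) (snd x) a b)" for z
  proof -
    obtain o' s p where zp: "z = ((o', s), p)" by (rule that[of "fst (fst z)" "snd (fst z)" "snd z"]) simp
    have x: "o' \<in> \<Omega>" "s \<in> matchings C W o'" "k (o', s) = l (o', s)" and p: "p \<in> trails C W o' s a b"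
      using z by (auto simp: zp X0_def X_def)
    have cl: "succ_closed C W o' s (set p)" by (rule trails_closed[OF x(2) p ab(2,3)])
    note fm = flip_matching[OF x(2) cl] and tf = trails_flip[OF x(2) p ab]
    have "set p \<subseteq> C" using p by (auto simp: trails_def)
    moreover have "rev p \<in> trails C W (flip_orient (set p) o') (flip_succ W o' (set p) s) b a"
      using tf(1) by blast
    \<comment> \<open>The marked trail makes \<open>k\<close> positive, so \<open>k - 1\<close> is a
      true subtraction and \<open>k = l\<close> turns into \<open>l = k + 2\<close>.\<close>
    moreover have "k (o', s) > 0"
      using p fT(2) by (auto simp: k_def card_gt_0_iff)
    moreover have "l (fst (?f z)) = l (o', s) + 1" "k (fst (?f z)) = k (o', s) - 1"
      using tf fT p by (simp_all add: zp l_def k_def)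
    ultimately show ?thesis
      using flip[OF x(1), of "set p"] fm x(3) by (simp add: zp X2_def X_def)
  qed
  have g: "?f z \<in> (SIGMA x:X0. trails C W (fst x) (snd x) a b) \<and> ?f (?f z) = z"
    if z: "z \<in> (SIGMA x:X2. trails C W (fst x) (snd x) b a)" for z
  proof -
    obtain o' s p where zp: "z = ((o', s), p)" by (rule that[of "fst (fst z)" "snd (fst z)" "snd z"]) simp
    have x: "o' \<in> \<Omega>" "s \<in> matchings C W o'" "l (o', s) = k (o', s) + 2"
      and p: "p \<in> trails C W o' s b a"
      using z by (auto simp: zp X2_def X_def)
    have cl: "succ_closed C W o' s (set p)" by (rule trails_closed[OF x(2) p ab(3,2)])
    note fm = flip_matching[OF x(2) cl] and tf = trails_flip[OF x(2) p ab(1)[symmetric] ab(3,2)]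
    have "set p \<subseteq> C" using p by (auto simp: trails_def)
    moreover have "rev p \<in> trails C W (flip_orient (set p) o') (flip_succ W o' (set p) s) a b"
      using tf(1) by blast
    moreover have "k (fst (?f z)) = k (o', s) + 1" "l (fst (?f z)) = l (o', s) - 1"
      using tf fT p by (simp_all add: zp l_def k_def)
    ultimately show ?thesis
      using flip[OF x(1), of "set p"] fm x(3) by (simp add: zp X0_def X_def)
  qed
  have "(\<Sum>o' | o' \<in> \<Omega> \<and> indeg C o' a = outdeg C o' a \<and> indeg C o' b = outdeg C o' b.
      \<Sum>s\<in>matchings C W o'.
        real (card (trails C W o' s a b)) / (real (card (trails C W o' s a b)) + 1)) =
    (\<Sum>x\<in>X0. real (k x) / (real (k x) + 1))"
  proof -
    have "(SIGMA o':{o' \<in> \<Omega>. indeg C o' a = outdeg C o' a \<and> indeg C o' b = outdeg C o' b}.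
        matchings C W o') = X0" (is "?L0 = _")
    proof (rule set_eqI, rule prod.induct)
      fix o' s
      show "(o', s) \<in> ?L0 \<longleftrightarrow> (o', s) \<in> X0" using deg[of o' s] by (auto simp: X0_def X_def)
    qed
    then show ?thesis
      using fin finite_matchings[OF fin(1)] by (subst sum.Sigma) (auto simp: k_def case_prod_unfold)
  qed
  \<comment> \<open>The weight \<open>k x / (k x + 1)\<close> is spread evenly over the
    \<open>k x\<close> trails that can be marked.\<close>
  also have "\<dots> = (\<Sum>x\<in>X0. \<Sum>p\<in>trails C W (fst x) (snd x) a b. 1 / (real (k x) + 1))"
    by (simp add: k_def case_prod_unfold)
  also have "\<dots> = (\<Sum>(x, p)\<in>(SIGMA x:X0. trails C W (fst x) (snd x) a b). 1 / (real (k x) + 1))"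
    using finX fT by (subst sum.Sigma) (auto simp: X0_def)
  also have "\<dots> = (\<Sum>(x, p)\<in>(SIGMA x:X2. trails C W (fst x) (snd x) b a). 1 / real (l x))"
  proof (rule sum.reindex_bij_witness[where i = ?f and j = ?f])
    fix z assume z: "z \<in> (SIGMA x:X0. trails C W (fst x) (snd x) a b)"
    show "?f z \<in> (SIGMA x:X2. trails C W (fst x) (snd x) b a)" "?f (?f z) = z"
      using f[OF z] by (rule conjunct1, rule conjunct1[OF conjunct2])
    have "l (fst (?f z)) = k (fst z) + 1" using f[OF z] by (elim conjE)
    then show "(case ?f z of (x, p) \<Rightarrow> 1 / real (l x)) = (case z of (x, p) \<Rightarrow> 1 / (real (k x) + 1))"
      by (simp only: case_prod_beta of_nat_add of_nat_1)
  next
    fix z assume z: "z \<in> (SIGMA x:X2. trails C W (fst x) (snd x) b a)"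
    show "?f z \<in> (SIGMA x:X0. trails C W (fst x) (snd x) a b)" "?f (?f z) = z"
      using g[OF z] by (rule conjunct1, rule conjunct2)
  qed
  also have "\<dots> = (\<Sum>x\<in>X2. \<Sum>p\<in>trails C W (fst x) (snd x) b a. 1 / real (l x))"
    using finX fT by (subst sum.Sigma) (auto simp: X2_def)
  \<comment> \<open>On \<open>X2\<close> the number \<open>l x\<close> is positive, so
    \<open>l x\<close> marked trails of weight \<open>1 / l x\<close> add up to one.\<close>
  also have "\<dots> = (\<Sum>x\<in>X2. 1)"
    by (rule sum.cong) (auto simp: X2_def l_def case_prod_unfold)
  also have "\<dots> = (\<Sum>o' | o' \<in> \<Omega> \<and> indeg C o' a = outdeg C o' a + 2 \<and> outdeg C o' b = indeg C o' b + 2.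
      \<Sum>s\<in>matchings C W o'. 1)"
  proof -
    have "(SIGMA o':{o' \<in> \<Omega>. indeg C o' a = outdeg C o' a + 2 \<and> outdeg C o' b = indeg C o' b + 2}.
        matchings C W o') = X2" (is "?L2 = _")
    proof (rule set_eqI, rule prod.induct)
      fix o' s
      show "(o', s) \<in> ?L2 \<longleftrightarrow> (o', s) \<in> X2" using deg[of o' s] by (auto simp: X2_def X_def)
    qed
    then show ?thesis
      using fin finite_matchings[OF fin(1)] by (subst sum.Sigma) auto
  qed
  finally show ?thesis by simp
qed

text \<open>Composition with one fixed bijection \<open>g\<close> turns permutations of
  \<open>A\<close> into bijections from \<open>A\<close> to \<open>B\<close>. Off \<open>A\<close>
  the former are the identity and the latter \<open>undefined\<close>; the two witnesses translate
  between these defaults.\<close>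

lemma card_extensional_bij_betw:
  assumes "finite A" "finite B" "card A = card B"
  shows "card {t \<in> extensional A. bij_betw t A B} = fact (card A)"
proof -
  obtain g where g: "bij_betw g A B" using finite_same_card_bij assms by blast
  let ?i = "\<lambda>p. restrict (g \<circ> p) A"
  let ?j = "\<lambda>t x. if x \<in> A then inv_into A g (t x) else x"
  have "bij_betw ?i {p. p permutes A} {t \<in> extensional A. bij_betw t A B}"
  proof (rule bij_betw_byWitness[where f' = ?j])
    show "\<forall>p\<in>{p. p permutes A}. ?j (?i p) = p"
    proof clarify
      fix p assume p: "p permutes A"
      show "?j (?i p) = p"
      proof
        fix x show "?j (?i p) x = p x"
          using bij_betw_inv_into_left[OF g, of "p x"] p
          by (cases "x \<in> A") (simp_all add: permutes_in_image permutes_not_in)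
      qed
    qed
    show "\<forall>t\<in>{t \<in> extensional A. bij_betw t A B}. ?i (?j t) = t"
    proof clarify
      fix t assume t: "t \<in> extensional A" "bij_betw t A B"
      show "?i (?j t) = t"
      proof
        fix x show "?i (?j t) x = t x"
          using bij_betw_inv_into_right[OF g, of "t x"] bij_betw_apply[OF t(2), of x] t(1)
          by (cases "x \<in> A") (simp_all add: extensional_def)
      qed
    qed
    show "?i ` {p. p permutes A} \<subseteq> {t \<in> extensional A. bij_betw t A B}"
    proof clarify
      fix p assume "p permutes A"
      then have gp: "bij_betw (g \<circ> p) A B" by (intro bij_betw_trans[OF permutes_imp_bij g])
      have "bij_betw (?i p) A B" by (rule bij_betw_cong[THEN iffD1, OF _ gp]) simp
      then show "?i p \<in> extensional A \<and> bij_betw (?i p) A B" by simp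
    qed
    show "?j ` {t \<in> extensional A. bij_betw t A B} \<subseteq> {p. p permutes A}"
    proof clarify
      fix t assume "bij_betw t A B"
      then have jt: "bij_betw (inv_into A g \<circ> t) A A"
        by (rule bij_betw_trans[OF _ bij_betw_inv_into[OF g]])
      have "bij_betw (?j t) A A" by (rule bij_betw_cong[THEN iffD1, OF _ jt]) simp
      then show "?j t permutes A" by (rule bij_imp_permutes) simp
    qed
  qed
  then have "card {t \<in> extensional A. bij_betw t A B} = card {p. p permutes A}"
    by (rule bij_betw_same_card[symmetric])
  then show ?thesis using card_permutations[OF refl assms(1)] by simp
qed

text \<open>The copies entering \<open>v\<close> are disjoint from those entering \<open>W\<close>,
  so a matching on \<open>insert v W\<close> is an independent choice of a matching on
  \<open>W\<close> and a bijection at \<open>v\<close>. The summand depends on the first choice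
  only.\<close>

lemma sum_matchings_insert:
  fixes g :: "('c \<Rightarrow> 'c) \<Rightarrow> real"
  assumes fin: "finite C" and v: "v \<notin> W" and bal: "indeg C o' v = outdeg C o' v"
  shows "(\<Sum>s\<in>matchings C (insert v W) o'. g (restrict s {c \<in> C. snd (o' c) \<in> W})) =
    fact (indeg C o' v) * (\<Sum>s\<in>matchings C W o'. g s)"
proof -
  let ?in = "{c \<in> C. snd (o' c) = v}" and ?out = "{c \<in> C. fst (o' c) = v}"
    and ?I = "{c \<in> C. snd (o' c) \<in> W}"
  let ?B = "{t \<in> extensional ?in. bij_betw t ?in ?out}"
  let ?j = "\<lambda>s. (restrict s ?I, restrict s ?in)"
  let ?i = "\<lambda>(s, t) c. if c \<in> ?in then t c else s c"
  have "(\<Sum>s\<in>matchings C (insert v W) o'. g (restrict s ?I)) = (\<Sum>(s, t)\<in>matchings C W o' \<times> ?B. g s)"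
  proof (rule sum.reindex_bij_witness[where i = ?i and j = ?j])
    fix s assume s: "s \<in> matchings C (insert v W) o'"
    show "?i (?j s) = s" using s by (auto simp: matchings_def extensional_def fun_eq_iff)
    have "bij_betw (restrict s ?I) {c \<in> C. snd (o' c) = w} {c \<in> C. fst (o' c) = w}" if "w \<in> W" for w
    proof -
      have "bij_betw s {c \<in> C. snd (o' c) = w} {c \<in> C. fst (o' c) = w}"
        using s that by (simp add: matchings_def)
      then show ?thesis by (rule bij_betw_cong[THEN iffD1, rotated]) (use that in auto)
    qed
    moreover have "bij_betw (restrict s ?in) ?in ?out"
    proof -
      have "bij_betw s ?in ?out" using s by (simp add: matchings_def)
      then show ?thesis by (rule bij_betw_cong[THEN iffD1, rotated]) auto
    qed
    ultimately show "?j s \<in> matchings C W o' \<times> ?B" by (simp add: matchings_def)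
    show "(case ?j s of (s, t) \<Rightarrow> g s) = g (restrict s ?I)" by simp
  next
    fix z assume z: "z \<in> matchings C W o' \<times> ?B"
    obtain s t where st: "z = (s, t)" by (cases z)
    have s: "s \<in> matchings C W o'" and t: "t \<in> extensional ?in" "bij_betw t ?in ?out"
      using z by (auto simp: st)
    show "?j (?i z) = z"
      using s t v by (auto simp: st matchings_def extensional_def fun_eq_iff restrict_def)
    have "bij_betw (?i z) {c \<in> C. snd (o' c) = w} {c \<in> C. fst (o' c) = w}" if w: "w \<in> insert v W" for w
    proof (cases "w = v")
      case True
      show ?thesis using t(2) unfolding True
        by (rule bij_betw_cong[THEN iffD1, rotated]) (auto simp: st)
    next
      case False
      then have "bij_betw s {c \<in> C. snd (o' c) = w} {c \<in> C. fst (o' c) = w}"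
        using s w by (simp add: matchings_def)
      then show ?thesis
        by (rule bij_betw_cong[THEN iffD1, rotated]) (use False in \<open>auto simp: st\<close>)
    qed
    then show "?i z \<in> matchings C (insert v W) o'"
      using s t by (auto simp: st matchings_def extensional_def)
  qed
  also have "\<dots> = (\<Sum>s\<in>matchings C W o'. \<Sum>t\<in>?B. g s)"
    by (rule sum.cartesian_product[symmetric])
  also have "\<dots> = fact (indeg C o' v) * (\<Sum>s\<in>matchings C W o'. g s)"
    using card_extensional_bij_betw[OF _ _ bal] fin by (simp add: sum_distrib_left)
  finally show ?thesis .
qed

lemma card_matchings:
  assumes "finite C" "finite W" "\<And>v. v \<in> W \<Longrightarrow> indeg C o' v = outdeg C o' v"
  shows "real (card (matchings C W o')) = (\<Prod>v\<in>W. fact (indeg C o' v))"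
  using assms(2,3)
proof (induction W)
  case empty
  have "matchings C {} o' = {\<lambda>_. undefined}"
    by (auto simp: matchings_def extensional_def)
  then show ?case by simp
next
  case (insert v W)
  then show ?case
    using sum_matchings_insert[OF assms(1), of v W o' "\<lambda>_. 1"] by simp
qed

lemma trails_cong:
  assumes "\<And>c. c \<in> C \<Longrightarrow> snd (o' c) \<in> W \<Longrightarrow> s c = t c"
  shows "trails C W o' s x y = trails C W o' t x y"
proof -
  have *: "trails C W o' s x y \<subseteq> trails C W o' t x y"
    if eq: "\<And>c. c \<in> C \<Longrightarrow> snd (o' c) \<in> W \<Longrightarrow> s c = t c" for s t
  proof
    fix cs assume "cs \<in> trails C W o' s x y"
    moreover from this have "s (cs ! i) = t (cs ! i)" if "Suc i < length cs" for i
      using that by (intro eq) (auto simp: trails_def subset_iff)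
    ultimately show "cs \<in> trails C W o' t x y" by (simp add: trails_def)
  qed
  show ?thesis using *[of s t] *[of t s] assms by simp
qed

text \<open>Trails between \<open>a\<close> and \<open>b\<close> use successors at vertices of
  \<open>W\<close> only, so their number ignores the matchings at \<open>a\<close> and
  \<open>b\<close>, and these contribute a mere factor.\<close>

lemma sum_matchings_trails:
  fixes h :: "nat \<Rightarrow> real"
  assumes fin: "finite C" and ab: "a \<noteq> b" "a \<notin> W" "b \<notin> W"
    and bal: "indeg C o' a = outdeg C o' a" "indeg C o' b = outdeg C o' b"
  shows "(\<Sum>s\<in>matchings C (insert a (insert b W)) o'. h (card (trails C W o' s a b))) =
    fact (indeg C o' a) * fact (indeg C o' b) *
      (\<Sum>s\<in>matchings C W o'. h (card (trails C W o' s a b)))"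
proof -
  have r: "trails C W o' (restrict s {c \<in> C. snd (o' c) \<in> U}) a b = trails C W o' s a b"
    if "W \<subseteq> U" for s U
    by (rule trails_cong) (use that in auto)
  show ?thesis
    using sum_matchings_insert[OF fin, of a "insert b W" o' "\<lambda>s. h (card (trails C W o' s a b))"]
      sum_matchings_insert[OF fin, of b W o' "\<lambda>s. h (card (trails C W o' s a b))"] ab bal
    by (simp add: r[of "insert b W", OF subset_insertI, simplified] r[OF order_refl])
qed

section \<open>Current expansion of the XY model\<close>

text \<open>The XY measure and the loop measure have the same form, so one computation serves both:
  the unnormalised mass is \<open>Z\<close>, and normalising multiplies the density by the constant
  \<open>1 / Z\<close>.\<close>

lemma
  fixes f :: "'b \<Rightarrow> 'c::{banach, second_countable_topology}" and w :: "'b \<Rightarrow> real"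
  assumes w: "has_bochner_integral M w Z" "\<And>x. x \<in> space M \<Longrightarrow> 0 \<le> w x" and Z: "Z > 0"
  shows prob_space_normalized_density: "prob_space (normalized (density M w))"
    and integral_normalized_density: "f \<in> borel_measurable M \<Longrightarrow>
      integral\<^sup>L (normalized (density M w)) f = (\<integral>x. w x *\<^sub>R f x \<partial>M) /\<^sub>R Z"
proof -
  have [measurable]: "w \<in> borel_measurable M" using w(1) by (rule borel_measurable_has_bochner_integral)
  have "emeasure (density M w) (space M) = (\<integral>\<^sup>+ x. ennreal (w x) \<partial>M)"
    by (simp add: emeasure_density cong: nn_integral_cong)
  also have "\<dots> = ennreal Z"
    using w by (subst nn_integral_eq_integral) (auto simp: has_bochner_integral_iff)
  finally have em: "emeasure (density M w) (space M) = ennreal Z" .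
  have n: "normalized (density M w) = density (density M w) (\<lambda>_. ennreal (1 / Z))"
    using Z by (simp add: normalized_def em divide_ennreal[symmetric])
  show "prob_space (normalized (density M w))"
  proof
    have "emeasure (normalized (density M w)) (space M) = ennreal (1 / Z) * ennreal Z"
      by (simp add: n emeasure_density em nn_integral_cmult_indicator)
    also have "\<dots> = 1" using Z by (simp flip: ennreal_mult')
    finally show "emeasure (normalized (density M w)) (space (normalized (density M w))) = 1"
      by (simp add: normalized_def)
  qed
  assume f[measurable]: "f \<in> borel_measurable M"
  show "integral\<^sup>L (normalized (density M w)) f = (\<integral>x. w x *\<^sub>R f x \<partial>M) /\<^sub>R Z"
    using w(2) Z by (simp add: n integral_density divide_inverse)
qed

section \<open>Integration of monomials over the circle and its powers\<close>

lemma circle_measure_borel [measurable]: "(\<lambda>z. z) \<in> borel_measurable circle_measure"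
  unfolding circle_measure_def by (simp add: measurable_restrict_space1)

lemma circle_monomial_borel: "(\<lambda>z. z ^ p * cnj z ^ q) \<in> borel_measurable circle_measure"
  by (rule measurable_compose[OF circle_measure_borel], rule borel_measurable_continuous_onI)
    (intro continuous_intros)

lemma space_circle_measure [simp]: "space circle_measure = sphere 0 1"
  by (simp add: circle_measure_def space_restrict_space)

lemma cis_measurable_circle [measurable]: "cis \<in> borel \<rightarrow>\<^sub>M restrict_space borel (sphere 0 1)"
  by (intro measurable_restrict_space2 borel_measurable_continuous_onI continuous_on_cis[OF continuous_on_id])
    simp

lemma prob_space_circle_measure: "prob_space circle_measure"
  unfolding circle_measure_def
proof (rule prob_space.prob_space_distr)
  show "prob_space (uniform_measure lborel {0..<2 * pi})"
    by (rule prob_space_uniform_measure) auto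
qed (simp add: uniform_measure_def)

lemma integral_cis_multiple:
  assumes "k \<noteq> (0 :: int)"
  shows "(\<integral>t. indicator {0..2 * pi} t *\<^sub>R cis (of_int k * t) \<partial>lborel) = 0"
proof -
  \<comment> \<open>An antiderivative, with equal values at \<open>0\<close> and
    \<open>2 * pi\<close> because \<open>k\<close> is an integer.\<close>
  let ?F = "\<lambda>t. cis (of_int k * t) / (\<i> * of_int k)"
  have "(\<integral>t. indicator {0..2 * pi} t *\<^sub>R cis (of_int k * t) \<partial>lborel) = ?F (2 * pi) - ?F 0"
  proof (rule integral_FTC_atLeastAtMost)
    show "continuous_on {0..2 * pi} (\<lambda>t. cis (of_int k * t))" by (intro continuous_intros)
    fix t :: real
    have "((\<lambda>t. cis (of_int k * t)) has_derivative (\<lambda>h. (of_int k * h) *\<^sub>R (\<i> * cis (of_int k * t))))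
        (at t within {0..2 * pi})"
      by (rule has_derivative_cis, rule has_derivative_mult_right, rule has_derivative_ident)
    then have "((\<lambda>t. cis (of_int k * t)) has_vector_derivative (\<i> * of_int k * cis (of_int k * t)))
        (at t within {0..2 * pi})"
      unfolding has_vector_derivative_def
      by (rule has_derivative_eq_rhs) (simp add: fun_eq_iff scaleR_conv_of_real)
    from has_vector_derivative_divide[OF this, of "\<i> * of_int k"]
    show "(?F has_vector_derivative cis (of_int k * t)) (at t within {0..2 * pi})"
      using assms by simp
  qed simp
  also have "cis (of_int k * (2 * pi)) = 1"
    using cis_multiple_2pi[of "of_int k"] by (simp add: mult.commute)
  finally show ?thesis by simp
qed

lemma integral_circle_measure:
  fixes f :: "complex \<Rightarrow> complex"
  assumes f: "f \<in> borel_measurable circle_measure"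
  shows "integral\<^sup>L circle_measure f =
    (\<integral>t. indicator {0..2 * pi} t *\<^sub>R f (cis t) \<partial>lborel) / (2 * pi)"
proof -
  let ?R = "restrict_space borel (sphere 0 1) :: complex measure"
  have f': "f \<in> borel_measurable ?R" using f by (simp add: circle_measure_def)
  then have fc[measurable]: "(\<lambda>t. f (cis t)) \<in> borel_measurable borel" by measurable
  have u: "uniform_measure lborel {0..<2 * pi} =
      density lborel (\<lambda>t. ennreal (indicator {0..<2 * pi} t / (2 * pi)))"
    unfolding uniform_measure_def
    by (intro density_cong) (auto simp: divide_ennreal[symmetric] split: split_indicator)
  have "integral\<^sup>L circle_measure f = (\<integral>t. f (cis t) \<partial>uniform_measure lborel {0..<2 * pi})"
    unfolding circle_measure_def by (rule integral_distr[OF _ f']) (simp add: uniform_measure_def)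
  also have "\<dots> = (\<integral>t. (indicator {0..<2 * pi} t / (2 * pi)) *\<^sub>R f (cis t) \<partial>lborel)"
    unfolding u by (rule integral_density) auto
  \<comment> \<open>The endpoint \<open>2 * pi\<close> is a null set; including it gives the closed
    interval to which the fundamental theorem of calculus applies.\<close>
  also have "\<dots> = (\<integral>t. (indicator {0..2 * pi} t *\<^sub>R f (cis t)) / (2 * pi) \<partial>lborel)"
    by (rule integral_cong_AE)
      (use AE_lborel_singleton[of "2 * pi"] in \<open>auto elim!: eventually_mono split: split_indicator
         simp: scaleR_conv_of_real\<close>)
  finally show ?thesis by simp
qed

text \<open>Orthogonality of characters: at \<open>cis t\<close> the integrand equals
  \<open>cis ((p - q) * t)\<close>, with the difference taken in the integers.\<close>

lemma integral_circle_monomial: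
  "(\<integral>z. z ^ p * cnj z ^ q \<partial>circle_measure) = of_bool (p = q)"
proof -
  have eq: "cis t ^ p * cnj (cis t) ^ q = cis (of_int (int p - int q) * t)" for t
    by (simp add: Complex.DeMoivre cis_cnj cis_mult algebra_simps)
  have "(\<integral>z. z ^ p * cnj z ^ q \<partial>circle_measure) =
      (\<integral>t. indicator {0..2 * pi} t *\<^sub>R (cis t ^ p * cnj (cis t) ^ q) \<partial>lborel) / (2 * pi)"
    by (rule integral_circle_measure[OF circle_monomial_borel])
  also have "\<dots> = of_bool (p = q)"
  proof (cases "p = q")
    case True
    then show ?thesis unfolding eq by (simp add: scaleR_conv_of_real del: of_real_mult)
  next
    case False
    then show ?thesis unfolding eq using integral_cis_multiple[of "int p - int q"] by simp
  qed
  finally show ?thesis .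
qed

interpretation circle: prob_space circle_measure by (rule prob_space_circle_measure)

abbreviation spin_measure :: "'a set \<Rightarrow> ('a \<Rightarrow> complex) measure" where
  "spin_measure V \<equiv> PiM V (\<lambda>_. circle_measure)"

text \<open>The integral factorises over the vertices, so one vertex with unequal exponents
  annihilates the monomial.\<close>

lemma integral_spin_monomial:
  assumes "finite V"
  shows "has_bochner_integral (spin_measure V) (\<lambda>\<sigma>. \<Prod>v\<in>V. \<sigma> v ^ p v * cnj (\<sigma> v) ^ q v)
    (of_bool (\<forall>v\<in>V. p v = q v))"
proof -
  interpret product_sigma_finite "\<lambda>_ :: 'a. circle_measure"
    by (rule product_sigma_finite.intro) (rule circle.sigma_finite_measure)
  have int: "integrable circle_measure (\<lambda>z. z ^ p v * cnj z ^ q v)" for v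
    by (rule circle.integrable_const_bound[where B = 1])
      (auto intro!: AE_I2 simp: norm_mult norm_power circle_monomial_borel)
  have "(\<Prod>v\<in>V. of_bool (p v = q v)) = (of_bool (\<forall>v\<in>V. p v = q v) :: complex)"
    using assms by (induction V) auto
  then show ?thesis
    using product_integrable_prod[OF assms int] product_integral_prod[OF assms int]
    by (simp add: has_bochner_integral_iff integral_circle_monomial)
qed

section \<open>Expansion of the Boltzmann weight over multiplicities and orientations\<close>

definition edge_copies :: "'a set set \<Rightarrow> ('a set \<Rightarrow> nat) \<Rightarrow> 'a edge_copy set" where
  "edge_copies E M = (SIGMA e:E. {..<M e})"

definition edge_orients :: "'a edge_copy set \<Rightarrow> ('a edge_copy \<Rightarrow> 'a \<times> 'a) set" where
  "edge_orients C = (\<Pi>\<^sub>E c\<in>C. orientations (fst c))"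

text \<open>Bounding all multiplicities by \<open>N\<close> truncates each edge factor of the Boltzmann weight to a
  partial sum of the exponential series.\<close>

definition mult_box :: "'a set set \<Rightarrow> nat \<Rightarrow> ('a set \<Rightarrow> nat) set" where
  "mult_box E N = {M. (\<forall>e. e \<notin> E \<longrightarrow> M e = 0) \<and> (\<forall>e\<in>E. M e < N)}"

definition mult_weight :: "'a set set \<Rightarrow> real \<Rightarrow> ('a set \<Rightarrow> nat) \<Rightarrow> real" where
  "mult_weight E \<beta> M = (\<Prod>e\<in>E. 1 / fact (M e) * (\<beta> / 2) ^ M e)"

text \<open>For an edge between \<open>v\<close> and \<open>w\<close> this is twice the real part of
  \<open>\<sigma> v * cnj (\<sigma> w)\<close>. Written as a sum over orientations, it lets the
  expansion of a power choose one orientation per edge copy.\<close>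

definition edge_spin :: "('a \<Rightarrow> complex) \<Rightarrow> 'a set \<Rightarrow> complex" where
  "edge_spin \<sigma> e = (\<Sum>(v, w)\<in>orientations e. \<sigma> v * cnj (\<sigma> w))"

definition xy_truncated :: "'a set set \<Rightarrow> real \<Rightarrow> nat \<Rightarrow> ('a \<Rightarrow> complex) \<Rightarrow> complex" where
  "xy_truncated E \<beta> N \<sigma> = (\<Prod>e\<in>E. \<Sum>n<N. (complex_of_real (\<beta> / 2) * edge_spin \<sigma> e) ^ n / fact n)"

lemma finite_graph_edges:
  assumes "finite_graph V E"
  shows "finite V" "finite E"
proof -
  show "finite V" using assms by (simp add: finite_graph_def)
  moreover have "E \<subseteq> Pow V" using assms by (auto simp: finite_graph_def)
  ultimately show "finite E" using finite_subset by blast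
qed

lemma finite_edge_copies: "finite E \<Longrightarrow> finite (edge_copies E M)"
  by (simp add: edge_copies_def)

lemma orientations_eq:
  assumes "finite_graph V E" "e \<in> E"
  obtains v w where "e = {v, w}" "v \<noteq> w" "v \<in> V" "w \<in> V" "orientations e = {(v, w), (w, v)}"
proof -
  obtain v w where "e = {v, w}" "v \<noteq> w"
    using assms by (auto simp: finite_graph_def card_2_iff)
  moreover from this have "orientations e = {(v, w), (w, v)}"
    by (auto simp: orientations_def doubleton_eq_iff)
  ultimately show ?thesis using that assms by (auto simp: finite_graph_def)
qed

lemma finite_orientations: "finite_graph V E \<Longrightarrow> e \<in> E \<Longrightarrow> finite (orientations e)"
  by (erule (1) orientations_eq) simp

lemma edge_orientsD:
  assumes "finite_graph V E" "o' \<in> edge_orients (edge_copies E M)" "c \<in> edge_copies E M"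
  shows "fst c = {fst (o' c), snd (o' c)}" "fst (o' c) \<noteq> snd (o' c)"
    "fst (o' c) \<in> V" "snd (o' c) \<in> V"
proof -
  have e: "fst c \<in> E" using assms(3) by (auto simp: edge_copies_def)
  have o': "o' c \<in> orientations (fst c)"
    using assms(2,3) by (auto simp: edge_orients_def PiE_iff)
  obtain v w where vw: "fst c = {v, w}" "v \<noteq> w" "v \<in> V" "w \<in> V"
    "orientations (fst c) = {(v, w), (w, v)}"
    using orientations_eq[OF assms(1) e] .
  have "o' c = (v, w) \<or> o' c = (w, v)" using o' vw(5) by simp
  then show "fst c = {fst (o' c), snd (o' c)}" "fst (o' c) \<noteq> snd (o' c)"
    "fst (o' c) \<in> V" "snd (o' c) \<in> V"
    by (elim disjE; simp add: vw(1,3,4) vw(2) vw(2)[symmetric] insert_commute)+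
qed

lemma finite_edge_orients:
  assumes "finite_graph V E"
  shows "finite (edge_orients (edge_copies E M))"
  unfolding edge_orients_def
  using finite_edge_copies finite_graph_edges[OF assms] finite_orientations[OF assms]
  by (intro finite_PiE) (auto simp: edge_copies_def)

lemma xy_density_eq_prod:
  assumes "finite_graph V E"
  shows "complex_of_real (xy_density E \<beta> \<sigma>) = (\<Prod>e\<in>E. exp (complex_of_real (\<beta> / 2) * edge_spin \<sigma> e))"
proof -
  have "complex_of_real (\<Sum>(v, w)\<in>orientations e. Re (\<sigma> v * cnj (\<sigma> w))) = edge_spin \<sigma> e"
    if "e \<in> E" for e
    by (rule orientations_eq[OF assms that]) (simp add: edge_spin_def complex_eq_iff)
  then have "complex_of_real (\<Sum>e\<in>E. \<beta> / 2 * (\<Sum>(v, w)\<in>orientations e. Re (\<sigma> v * cnj (\<sigma> w)))) =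
      (\<Sum>e\<in>E. complex_of_real (\<beta> / 2) * edge_spin \<sigma> e)"
    unfolding of_real_sum[of _ E] of_real_mult[of "\<beta> / 2"] by (intro sum.cong) auto
  moreover have "xy_density E \<beta> \<sigma> =
      exp (\<Sum>e\<in>E. \<beta> / 2 * (\<Sum>(v, w)\<in>orientations e. Re (\<sigma> v * cnj (\<sigma> w))))"
    unfolding xy_density_def sum_distrib_left[symmetric] by simp
  ultimately have "complex_of_real (xy_density E \<beta> \<sigma>) =
      exp (\<Sum>e\<in>E. complex_of_real (\<beta> / 2) * edge_spin \<sigma> e)"
    by (simp only: exp_of_real[symmetric])
  then show ?thesis using exp_sum[OF finite_graph_edges(2)[OF assms]] by simp
qed

lemma norm_edge_spin:
  assumes "finite_graph V E" "e \<in> E" "\<And>v. v \<in> V \<Longrightarrow> norm (\<sigma> v) = 1"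
  shows "norm (edge_spin \<sigma> e) \<le> 2"
  by (rule orientations_eq[OF assms(1,2)])
    (simp add: edge_spin_def, rule order.trans[OF norm_triangle_ineq], simp add: norm_mult assms(3))

lemma xy_truncated_tendsto:
  assumes "finite_graph V E"
  shows "(\<lambda>N. xy_truncated E \<beta> N \<sigma>) \<longlonglongrightarrow> complex_of_real (xy_density E \<beta> \<sigma>)"
  unfolding xy_density_eq_prod[OF assms] xy_truncated_def
proof (rule tendsto_prod)
  fix e
  show "(\<lambda>N. \<Sum>n<N. (complex_of_real (\<beta> / 2) * edge_spin \<sigma> e) ^ n / fact n)
      \<longlonglongrightarrow> exp (complex_of_real (\<beta> / 2) * edge_spin \<sigma> e)"
  proof -
    have "x ^ n /\<^sub>R fact n = x ^ n / fact n" for x :: complex and n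
      by (simp add: scaleR_conv_of_real field_simps)
    then show ?thesis
      using exp_converges[of "complex_of_real (\<beta> / 2) * edge_spin \<sigma> e"] by (simp only: sums_def)
  qed
qed

text \<open>Each edge term has modulus at most \<open>\<beta>\<close>, so a partial exponential sum
  is at most \<open>exp \<beta>\<close>. The bound is uniform in \<open>N\<close>, as dominated
  convergence demands.\<close>

lemma norm_xy_truncated_le:
  assumes "finite_graph V E" "\<beta> > 0" "\<And>v. v \<in> V \<Longrightarrow> norm (\<sigma> v) = 1"
  shows "norm (xy_truncated E \<beta> N \<sigma>) \<le> (\<Prod>e\<in>E. exp \<beta>)"
  unfolding xy_truncated_def prod_norm[symmetric]
proof (rule prod_mono, safe)
  fix e assume e: "e \<in> E"
  have "norm (\<Sum>n<N. (complex_of_real (\<beta> / 2) * edge_spin \<sigma> e) ^ n / fact n) \<le> (\<Sum>n<N. \<beta> ^ n / fact n)"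
  proof (rule sum_norm_le)
    fix n
    have "norm (complex_of_real (\<beta> / 2) * edge_spin \<sigma> e) \<le> \<beta> / 2 * 2"
      unfolding norm_mult using norm_edge_spin[OF assms(1) e, of \<sigma>] assms(2,3)
      by (intro mult_mono) auto
    then have "norm (complex_of_real (\<beta> / 2) * edge_spin \<sigma> e) ^ n \<le> \<beta> ^ n" by (intro power_mono) auto
    then show "norm ((complex_of_real (\<beta> / 2) * edge_spin \<sigma> e) ^ n / fact n) \<le> \<beta> ^ n / fact n"
      by (simp add: norm_divide norm_power divide_right_mono)
  qed
  also have "\<dots> \<le> exp \<beta>"
    using sum_le_suminf[OF summable_exp_generic[of \<beta>], of "{..<N}"] assms(2)
    by (simp add: exp_def divide_inverse mult.commute)
  finally show "norm (\<Sum>n<N. (complex_of_real (\<beta> / 2) * edge_spin \<sigma> e) ^ n / fact n) \<le> exp \<beta>" .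
qed simp

lemma sum_mult_box:
  assumes "finite E"
  shows "(\<Prod>e\<in>E. \<Sum>n<N. f e n) = (\<Sum>M\<in>mult_box E N. \<Prod>e\<in>E. (f e (M e) :: 'b::comm_semiring_1))"
proof -
  have "(\<Prod>e\<in>E. \<Sum>n<N. f e n) = (\<Sum>M\<in>PiE E (\<lambda>_. {..<N}). \<Prod>e\<in>E. f e (M e))"
    using assms by (intro prod_sum_PiE) auto
  \<comment> \<open>Off \<open>E\<close>, functions in \<open>PiE\<close> are
    \<open>undefined\<close> while multiplicities are \<open>0\<close>; the witnesses exchange the
    two defaults.\<close>
  also have "\<dots> = (\<Sum>M\<in>mult_box E N. \<Prod>e\<in>E. f e (M e))"
    by (rule sum.reindex_bij_witness[where i = "\<lambda>M. restrict M E" and j = "\<lambda>M e. if e \<in> E then M e else 0"])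
      (auto simp: mult_box_def PiE_iff extensional_def fun_eq_iff)
  finally show ?thesis .
qed

lemma finite_mult_box:
  assumes "finite E"
  shows "finite (mult_box E N)"
proof (rule finite_subset)
  show "mult_box E N \<subseteq> (\<lambda>M e. if e \<in> E then M e else 0) ` (PiE E (\<lambda>_. {..<N}))"
  proof
    fix M assume "M \<in> mult_box E N"
    then have "M = (\<lambda>e. if e \<in> E then restrict M E e else 0)" "restrict M E \<in> PiE E (\<lambda>_. {..<N})"
      by (auto simp: mult_box_def)
    then show "M \<in> (\<lambda>M e. if e \<in> E then M e else 0) ` (PiE E (\<lambda>_. {..<N}))" by blast
  qed
qed (use assms in \<open>simp add: finite_PiE\<close>)

lemma prod_eq_prod_power:
  fixes f :: "'v \<Rightarrow> 'b::comm_monoid_mult"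
  assumes "finite V" "finite C" "\<And>c. c \<in> C \<Longrightarrow> h c \<in> V"
  shows "(\<Prod>c\<in>C. f (h c)) = (\<Prod>v\<in>V. f v ^ card {c \<in> C. h c = v})"
proof -
  have "(\<Prod>c\<in>C. f (h c)) = (\<Prod>v\<in>V. \<Prod>c\<in>{c \<in> C. h c = v}. f (h c))"
    using assms by (intro prod.group[symmetric]) auto
  also have "\<dots> = (\<Prod>v\<in>V. f v ^ card {c \<in> C. h c = v})" by (intro prod.cong) auto
  finally show ?thesis .
qed

text \<open>Expanding \<open>edge_spin \<sigma> e ^ M e\<close> orients each of the
  \<open>M e\<close> copies of \<open>e\<close>. A copy contributes the spin of its tail and the
  conjugate spin of its head, and collecting these by vertex produces the degrees as
  exponents.\<close>

lemma xy_truncated_expand: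
  assumes "finite_graph V E"
  shows "xy_truncated E \<beta> N \<sigma> = (\<Sum>M\<in>mult_box E N. mult_weight E \<beta> M *
    (\<Sum>o'\<in>edge_orients (edge_copies E M).
      \<Prod>v\<in>V. \<sigma> v ^ outdeg (edge_copies E M) o' v * cnj (\<sigma> v) ^ indeg (edge_copies E M) o' v))"
proof -
  note fin = finite_graph_edges[OF assms]
  have 1: "(\<Prod>e\<in>E. edge_spin \<sigma> e ^ M e) = (\<Sum>o'\<in>edge_orients (edge_copies E M).
      \<Prod>v\<in>V. \<sigma> v ^ outdeg (edge_copies E M) o' v * cnj (\<sigma> v) ^ indeg (edge_copies E M) o' v)" for M
  proof -
    let ?C = "edge_copies E M"
    have finC: "finite ?C" by (rule finite_edge_copies[OF fin(2)])
    have "(\<Prod>e\<in>E. edge_spin \<sigma> e ^ M e) = (\<Prod>e\<in>E. \<Prod>i<M e. edge_spin \<sigma> e)"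
      by simp
    also have "\<dots> = (\<Prod>c\<in>?C. edge_spin \<sigma> (fst c))"
      unfolding edge_copies_def using fin(2)
      by (subst prod.Sigma) (auto simp: case_prod_unfold)
    also have "\<dots> = (\<Prod>c\<in>?C. \<Sum>p\<in>orientations (fst c). \<sigma> (fst p) * cnj (\<sigma> (snd p)))"
      by (simp add: edge_spin_def case_prod_unfold)
    also have "\<dots> = (\<Sum>o'\<in>edge_orients ?C. \<Prod>c\<in>?C. \<sigma> (fst (o' c)) * cnj (\<sigma> (snd (o' c))))"
      unfolding edge_orients_def using finC finite_orientations[OF assms]
      by (intro prod_sum_PiE) (auto simp: edge_copies_def)
    also have "\<dots> = (\<Sum>o'\<in>edge_orients ?C.
        \<Prod>v\<in>V. \<sigma> v ^ outdeg ?C o' v * cnj (\<sigma> v) ^ indeg ?C o' v)"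
    proof (rule sum.cong[OF refl])
      fix o' assume o': "o' \<in> edge_orients ?C"
      show "(\<Prod>c\<in>?C. \<sigma> (fst (o' c)) * cnj (\<sigma> (snd (o' c)))) =
          (\<Prod>v\<in>V. \<sigma> v ^ outdeg ?C o' v * cnj (\<sigma> v) ^ indeg ?C o' v)"
        using prod_eq_prod_power[OF fin(1) finC, of "\<lambda>c. fst (o' c)" \<sigma>]
          prod_eq_prod_power[OF fin(1) finC, of "\<lambda>c. snd (o' c)" "\<lambda>v. cnj (\<sigma> v)"]
          edge_orientsD(3,4)[OF assms o']
        by (simp add: prod.distrib)
    qed
    finally show ?thesis .
  qed
  have "xy_truncated E \<beta> N \<sigma> =
      (\<Sum>M\<in>mult_box E N. \<Prod>e\<in>E. (complex_of_real (\<beta> / 2) * edge_spin \<sigma> e) ^ M e / fact (M e))"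
    unfolding xy_truncated_def by (rule sum_mult_box[OF fin(2)])
  also have "\<dots> = (\<Sum>M\<in>mult_box E N. mult_weight E \<beta> M * (\<Prod>e\<in>E. edge_spin \<sigma> e ^ M e))"
    by (simp add: mult_weight_def power_mult_distrib power_divide mult.commute flip: prod.distrib)
  finally show ?thesis unfolding 1 .
qed

text \<open>With \<open>p\<close> and \<open>q\<close> the exponents of an observable in the spins
  and their conjugates, the condition on \<open>o'\<close> is that its monomial times the observable
  survives integration.\<close>

definition current_count :: "'a set \<Rightarrow> 'a edge_copy set \<Rightarrow> ('a \<Rightarrow> nat) \<Rightarrow> ('a \<Rightarrow> nat) \<Rightarrow> nat" where
  "current_count V C p q =
     card {o' \<in> edge_orients C. \<forall>v\<in>V. outdeg C o' v + p v = indeg C o' v + q v}"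

text \<open>For the truncated weight the integral is a finite sum of monomial integrals, each
  \<open>0\<close> or \<open>1\<close>, hence a weighted count of orientations. Dominated
  convergence then removes the truncation.\<close>

lemma xy_monomial_limit:
  assumes "finite_graph V E" "\<beta> > 0"
  shows "integrable (spin_measure V)
      (\<lambda>\<sigma>. complex_of_real (xy_density E \<beta> \<sigma>) * (\<Prod>v\<in>V. \<sigma> v ^ p v * cnj (\<sigma> v) ^ q v))" (is ?int)
    and "(\<lambda>N. complex_of_real
      (\<Sum>M\<in>mult_box E N. mult_weight E \<beta> M * real (current_count V (edge_copies E M) p q)))
      \<longlonglongrightarrow> (\<integral>\<sigma>. complex_of_real (xy_density E \<beta> \<sigma>) * (\<Prod>v\<in>V. \<sigma> v ^ p v * cnj (\<sigma> v) ^ q v)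
        \<partial>spin_measure V)" (is ?lim)
proof -
  note fin = finite_graph_edges[OF assms(1)]
  interpret spin: prob_space "spin_measure V"
    by (intro prob_space_PiM prob_space_circle_measure)
  let ?m = "\<lambda>\<sigma>. \<Prod>v\<in>V. \<sigma> v ^ p v * cnj (\<sigma> v) ^ q v"
  let ?t = "\<lambda>N \<sigma>. xy_truncated E \<beta> N \<sigma> * ?m \<sigma>"
  have has: "has_bochner_integral (spin_measure V) (?t N) (complex_of_real
      (\<Sum>M\<in>mult_box E N. mult_weight E \<beta> M * real (current_count V (edge_copies E M) p q)))" for N
  proof -
    have t: "?t N = (\<lambda>\<sigma>. \<Sum>M\<in>mult_box E N. mult_weight E \<beta> M *
      (\<Sum>o'\<in>edge_orients (edge_copies E M).
        \<Prod>v\<in>V. \<sigma> v ^ (outdeg (edge_copies E M) o' v + p v) *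
          cnj (\<sigma> v) ^ (indeg (edge_copies E M) o' v + q v)))"
    proof
      fix \<sigma> :: "'a \<Rightarrow> complex"
      have "(\<Prod>v\<in>V. \<sigma> v ^ x v * cnj (\<sigma> v) ^ y v) * ?m \<sigma> =
          (\<Prod>v\<in>V. \<sigma> v ^ (x v + p v) * cnj (\<sigma> v) ^ (y v + q v))" for x y
        unfolding prod.distrib[symmetric] by (intro prod.cong) (simp_all add: power_add)
      then show "?t N \<sigma> = (\<Sum>M\<in>mult_box E N. mult_weight E \<beta> M *
        (\<Sum>o'\<in>edge_orients (edge_copies E M).
          \<Prod>v\<in>V. \<sigma> v ^ (outdeg (edge_copies E M) o' v + p v) *
            cnj (\<sigma> v) ^ (indeg (edge_copies E M) o' v + q v)))"
        by (simp only: xy_truncated_expand[OF assms(1)] sum_distrib_right mult.assoc)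
    qed
    have c: "complex_of_real
        (\<Sum>M\<in>mult_box E N. mult_weight E \<beta> M * real (current_count V (edge_copies E M) p q)) =
      (\<Sum>M\<in>mult_box E N. mult_weight E \<beta> M * (\<Sum>o'\<in>edge_orients (edge_copies E M).
        (of_bool (\<forall>v\<in>V. outdeg (edge_copies E M) o' v + p v =
          indeg (edge_copies E M) o' v + q v) :: complex)))"
    proof -
      have "complex_of_real (real (current_count V C p q)) = (\<Sum>o'\<in>edge_orients C.
          of_bool (\<forall>v\<in>V. outdeg C o' v + p v = indeg C o' v + q v))"
        if "finite (edge_orients C)" for C
        using that by (simp add: current_count_def Int_def)
      then show ?thesis
        using finite_edge_orients[OF assms(1)] by (simp only: of_real_sum of_real_mult)
    qed
    show ?thesis unfolding t c
      by (intro has_bochner_integral_sum has_bochner_integral_mult_right integral_spin_monomial fin)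
  qed
  have space: "norm (\<sigma> v) = 1" if "\<sigma> \<in> space (spin_measure V)" "v \<in> V" for \<sigma> v
    using that by (auto simp: space_PiM PiE_iff)
  have lim: "(\<lambda>N. ?t N \<sigma>) \<longlonglongrightarrow> complex_of_real (xy_density E \<beta> \<sigma>) * ?m \<sigma>" for \<sigma>
    by (intro tendsto_mult xy_truncated_tendsto[OF assms(1)] tendsto_const)
  have meas: "?t N \<in> borel_measurable (spin_measure V)" for N
    using has by (rule borel_measurable_has_bochner_integral)
  have meas': "(\<lambda>\<sigma>. complex_of_real (xy_density E \<beta> \<sigma>) * ?m \<sigma>) \<in> borel_measurable (spin_measure V)"
    by (rule borel_measurable_LIMSEQ_metric[OF meas lim])
  have bound: "AE \<sigma> in spin_measure V. norm (?t N \<sigma>) \<le> (\<Prod>e\<in>E. exp \<beta>)" for N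
  proof (rule AE_I2)
    fix \<sigma> assume s: "\<sigma> \<in> space (spin_measure V)"
    have "norm (?m \<sigma>) = 1" using space[OF s] by (simp add: norm_mult norm_power flip: prod_norm)
    then show "norm (?t N \<sigma>) \<le> (\<Prod>e\<in>E. exp \<beta>)"
      using norm_xy_truncated_le[OF assms space[OF s]] by (simp add: norm_mult)
  qed
  show ?int
    by (rule integrable_dominated_convergence[OF meas' meas spin.integrable_const AE_I2[OF lim] bound])
  have "(\<lambda>N. integral\<^sup>L (spin_measure V) (?t N)) \<longlonglongrightarrow>
      (\<integral>\<sigma>. complex_of_real (xy_density E \<beta> \<sigma>) * ?m \<sigma> \<partial>spin_measure V)"
    by (rule integral_dominated_convergence[OF meas' meas spin.integrable_const AE_I2[OF lim] bound])
  then show ?lim using has_bochner_integral_integral_eq[OF has] by simp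
qed

section \<open>Loop configurations\<close>

definition half_degree :: "'a set set \<Rightarrow> ('a set \<Rightarrow> nat) \<Rightarrow> 'a \<Rightarrow> nat" where
  "half_degree E M v = (\<Sum>e\<in>{e\<in>E. v \<in> e}. M e) div 2"

text \<open>Each copy at \<open>v\<close> either enters or leaves \<open>v\<close>, and never both
  because its two endpoints differ; so the degree is \<open>indeg + outdeg\<close>.\<close>

lemma half_degree_eq:
  assumes "finite_graph V E" "o' \<in> edge_orients (edge_copies E M)"
    and "indeg (edge_copies E M) o' v = outdeg (edge_copies E M) o' v"
  shows "half_degree E M v = indeg (edge_copies E M) o' v"
proof -
  let ?C = "edge_copies E M"
  have fin: "finite E" "finite ?C"
    using finite_graph_edges(2)[OF assms(1)] finite_edge_copies by blast+
  have "(\<Sum>e\<in>{e\<in>E. v \<in> e}. M e) = card (SIGMA e:{e\<in>E. v \<in> e}. {..<M e})"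
    using fin by (subst card_SigmaI) auto
  also have "(SIGMA e:{e\<in>E. v \<in> e}. {..<M e}) = {c \<in> ?C. v \<in> fst c}"
    by (auto simp: edge_copies_def)
  also have "{c \<in> ?C. v \<in> fst c} = {c \<in> ?C. snd (o' c) = v} \<union> {c \<in> ?C. fst (o' c) = v}"
    using edge_orientsD(1)[OF assms(1,2)] by (auto simp: set_eq_iff)
  also have "card \<dots> = indeg ?C o' v + outdeg ?C o' v"
    using edge_orientsD(2)[OF assms(1,2)] fin by (intro card_Un_disjoint) auto
  finally show ?thesis using assms(3) by (simp add: half_degree_def)
qed

lemma flip_orient_edge_orients:
  assumes "o' \<in> edge_orients C" "S \<subseteq> C"
  shows "flip_orient S o' \<in> edge_orients C"
proof -
  have "prod.swap p \<in> orientations e" if "p \<in> orientations e" for p :: "'a \<times> 'a" and e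
    using that by (cases p) (simp add: orientations_def insert_commute)
  then show ?thesis
    using assms by (auto simp: edge_orients_def PiE_iff flip_orient_def extensional_def)
qed

text \<open>A vertex with unequal in- and out-degree admits no matching, which the indicator
  records; each balanced vertex contributes a factorial.\<close>

lemma card_matchings_half_degree:
  assumes G: "finite_graph V E" and o': "o' \<in> edge_orients (edge_copies E M)" and W: "W \<subseteq> V"
  shows "real (card (matchings (edge_copies E M) W o')) =
    (\<Prod>v\<in>W. fact (half_degree E M v)) *
      of_bool (\<forall>v\<in>W. indeg (edge_copies E M) o' v = outdeg (edge_copies E M) o' v)"
proof (cases "\<forall>v\<in>W. indeg (edge_copies E M) o' v = outdeg (edge_copies E M) o' v")
  case True
  have "finite W" using W finite_graph_edges(1)[OF G] finite_subset by blast
  then have "real (card (matchings (edge_copies E M) W o')) =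
      (\<Prod>v\<in>W. fact (indeg (edge_copies E M) o' v))"
    using True finite_edge_copies[OF finite_graph_edges(2)[OF G]] by (intro card_matchings) auto
  also have "\<dots> = (\<Prod>v\<in>W. fact (half_degree E M v))"
    using True half_degree_eq[OF G o'] by (intro prod.cong) auto
  finally show ?thesis using True by simp
next
  case False
  have "matchings (edge_copies E M) W o' = {}"
  proof (rule equals0I)
    fix s assume "s \<in> matchings (edge_copies E M) W o'"
    from matchings_balanced[OF this] show False using False by simp
  qed
  then show ?thesis using False by simp
qed

lemma sum_matchings_current_count:
  assumes G: "finite_graph V E"
  shows "(\<Sum>o'\<in>edge_orients (edge_copies E M). \<Sum>s\<in>matchings (edge_copies E M) V o'.
      \<Prod>v\<in>V. 1 / fact (half_degree E M v)) =
    real (current_count V (edge_copies E M) (\<lambda>_. 0) (\<lambda>_. 0))"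
proof -
  let ?C = "edge_copies E M"
  have "(\<Sum>o'\<in>edge_orients ?C. \<Sum>s\<in>matchings ?C V o'. \<Prod>v\<in>V. 1 / fact (half_degree E M v)) =
      (\<Sum>o'\<in>edge_orients ?C. of_bool (\<forall>v\<in>V. indeg ?C o' v = outdeg ?C o' v) :: real)"
  proof (rule sum.cong[OF refl])
    fix o' assume o': "o' \<in> edge_orients ?C"
    have "(\<Prod>v\<in>V. fact (half_degree E M v) :: real) \<noteq> 0"
      using finite_graph_edges(1)[OF G] by simp
    then show "(\<Sum>s\<in>matchings ?C V o'. \<Prod>v\<in>V. 1 / fact (half_degree E M v)) =
        (of_bool (\<forall>v\<in>V. indeg ?C o' v = outdeg ?C o' v) :: real)"
      using card_matchings_half_degree[OF G o' order_refl] by (simp add: prod_dividef)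
  qed
  also have "\<dots> = real (current_count V ?C (\<lambda>_. 0) (\<lambda>_. 0))"
    using finite_edge_orients[OF G] by (simp add: current_count_def Int_def eq_commute)
  finally show ?thesis .
qed

text \<open>Factorials are cancelled in two rounds: those at \<open>a\<close> and \<open>b\<close>
  while the flow is balanced there, and those at \<open>W\<close> after the trail reversal, when
  \<open>a\<close> and \<open>b\<close> have become unbalanced.\<close>

lemma sum_trails_current_count:
  assumes G: "finite_graph V E" and ab: "a \<in> V" "b \<in> V" "a \<noteq> b"
  shows "(\<Sum>o'\<in>edge_orients (edge_copies E M). \<Sum>s\<in>matchings (edge_copies E M) V o'.
      (\<Prod>v\<in>V. 1 / fact (half_degree E M v)) *
        (real (card (trails (edge_copies E M) (V - {a, b}) o' s a b)) /
          (real (card (trails (edge_copies E M) (V - {a, b}) o' s a b)) + 1))) =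
    real (current_count V (edge_copies E M)
      (\<lambda>v. if v = a then 2 else 0) (\<lambda>v. if v = b then 2 else 0))"
proof -
  define C where "C = edge_copies E M"
  define W where "W = V - {a, b}"
  define h :: "nat \<Rightarrow> real" where "h k = real k / (real k + 1)" for k
  define D :: "'a \<Rightarrow> real" where "D v = fact (half_degree E M v)" for v
  let ?B = "{o' \<in> edge_orients C. indeg C o' a = outdeg C o' a \<and> indeg C o' b = outdeg C o' b}"
  let ?B2 = "{o' \<in> edge_orients C. indeg C o' a = outdeg C o' a + 2 \<and> outdeg C o' b = indeg C o' b + 2}"
  have V: "V = insert a (insert b W)" and W: "a \<notin> W" "b \<notin> W" "W \<subseteq> V" using ab by (auto simp: W_def)
  have finV: "finite V" and finC: "finite C"
    using finite_graph_edges[OF G] finite_edge_copies by (auto simp: C_def)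
  have finW: "finite W" using finV by (simp add: W_def)
  have finO: "finite (edge_orients C)" unfolding C_def by (rule finite_edge_orients[OF G])
  have DW: "(\<Prod>v\<in>W. D v) \<noteq> 0" using finW by (simp add: D_def)
  have D: "(\<Prod>v\<in>V. 1 / D v) = 1 / D a * (1 / D b) * (1 / (\<Prod>v\<in>W. D v))"
    using finW W ab by (simp add: V prod_dividef)
  have "(\<Sum>o'\<in>edge_orients C. \<Sum>s\<in>matchings C V o'.
      (\<Prod>v\<in>V. 1 / D v) * h (card (trails C W o' s a b))) =
    (\<Sum>o'\<in>?B. \<Sum>s\<in>matchings C V o'. (\<Prod>v\<in>V. 1 / D v) * h (card (trails C W o' s a b)))"
  \<comment> \<open>Orientations that are unbalanced at \<open>a\<close> or \<open>b\<close> carry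
    no matching on \<open>V\<close> and drop out.\<close>
  proof (rule sum.mono_neutral_right[OF finO], blast, rule ballI)
    fix o' assume o': "o' \<in> edge_orients C - ?B"
    have "matchings C V o' = {}"
    proof (rule equals0I)
      fix s assume "s \<in> matchings C V o'"
      then show False using matchings_balanced[of s C V o'] ab o' by auto
    qed
    then show "(\<Sum>s\<in>matchings C V o'. (\<Prod>v\<in>V. 1 / D v) * h (card (trails C W o' s a b))) = 0"
      by simp
  qed
  also have "\<dots> = (\<Sum>o'\<in>?B. 1 / (\<Prod>v\<in>W. D v) * (\<Sum>s\<in>matchings C W o'. h (card (trails C W o' s a b))))"
  proof (rule sum.cong[OF refl])
    fix o' assume o': "o' \<in> ?B"
    have Dab: "D v = fact (indeg C o' v)" if "v \<in> {a, b}" for v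
      using half_degree_eq[OF G, of o' M v] o' that by (auto simp: D_def C_def)
    have "(\<Sum>s\<in>matchings C V o'. h (card (trails C W o' s a b))) =
        D a * D b * (\<Sum>s\<in>matchings C W o'. h (card (trails C W o' s a b)))"
      using sum_matchings_trails[OF finC ab(3) W(1,2), of o' h] o' by (simp add: V Dab)
    moreover have "D a \<noteq> 0" "D b \<noteq> 0" by (simp_all add: D_def)
    ultimately show "(\<Sum>s\<in>matchings C V o'. (\<Prod>v\<in>V. 1 / D v) * h (card (trails C W o' s a b))) =
        1 / (\<Prod>v\<in>W. D v) * (\<Sum>s\<in>matchings C W o'. h (card (trails C W o' s a b)))"
      by (simp add: D sum_distrib_left[symmetric] sum_divide_distrib[symmetric])
  qed
  also have "\<dots> = 1 / (\<Prod>v\<in>W. D v) *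
      (\<Sum>o'\<in>?B. \<Sum>s\<in>matchings C W o'. h (card (trails C W o' s a b)))"
    by (rule sum_distrib_left[symmetric])
  also have "(\<Sum>o'\<in>?B. \<Sum>s\<in>matchings C W o'. h (card (trails C W o' s a b))) =
      (\<Sum>o'\<in>?B2. real (card (matchings C W o')))"
    unfolding h_def
  proof (rule sum_trails_weight_eq_card[OF finC finO _ _ ab(3) W(1,2)])
    show "fst (o' c) \<in> W \<union> {a, b} \<and> snd (o' c) \<in> W \<union> {a, b}"
      if "o' \<in> edge_orients C" "c \<in> C" for o' c
      using edge_orientsD(3,4)[OF G, of o' M c] that by (auto simp: C_def V)
  qed (rule flip_orient_edge_orients)
  also have "1 / (\<Prod>v\<in>W. D v) * (\<Sum>o'\<in>?B2. real (card (matchings C W o'))) =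
      (\<Sum>o'\<in>?B2. of_bool (\<forall>v\<in>W. indeg C o' v = outdeg C o' v))"
    unfolding sum_distrib_left
  proof (rule sum.cong[OF refl])
    fix o' assume "o' \<in> ?B2"
    then show "1 / (\<Prod>v\<in>W. D v) * real (card (matchings C W o')) =
        of_bool (\<forall>v\<in>W. indeg C o' v = outdeg C o' v)"
      using card_matchings_half_degree[OF G, of o' M W] W(3) DW by (simp add: C_def D_def)
  qed
  also have "\<dots> = real (card (?B2 \<inter> {o'. \<forall>v\<in>W. indeg C o' v = outdeg C o' v}))"
    using finO by simp
  \<comment> \<open>The surplus of two at \<open>a\<close> and \<open>b\<close> is exactly what
    compensates the exponents of the squared spin at \<open>a\<close> and the squared conjugate at
    \<open>b\<close>.\<close>
  also have "?B2 \<inter> {o'. \<forall>v\<in>W. indeg C o' v = outdeg C o' v} = {o' \<in> edge_orients C.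
      \<forall>v\<in>V. outdeg C o' v + (if v = a then 2 else 0) = indeg C o' v + (if v = b then 2 else 0)}"
    using W ab by (auto simp: V)
  finally show ?thesis by (simp add: C_def D_def h_def W_def current_count_def)
qed

section \<open>Loop configurations as triples, and pieces of loops as trails\<close>

lemma copies_eq: "copies E \<omega> = edge_copies E (mult \<omega>)"
  by (auto simp: copies_def edge_copies_def)

lemma loop_configs_iff:
  assumes G: "finite_graph V E"
  shows "\<omega> \<in> loop_configs V E \<longleftrightarrow> (\<forall>e. e \<notin> E \<longrightarrow> mult \<omega> e = 0) \<and>
    orient \<omega> \<in> edge_orients (edge_copies E (mult \<omega>)) \<and>
    succ \<omega> \<in> matchings (edge_copies E (mult \<omega>)) V (orient \<omega>)"
proof -
  have "{c \<in> edge_copies E (mult \<omega>). snd (orient \<omega> c) \<in> V} = edge_copies E (mult \<omega>)"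
    if "orient \<omega> \<in> edge_orients (edge_copies E (mult \<omega>))"
    using edge_orientsD(4)[OF G that] by auto
  then show ?thesis
    by (auto simp: loop_configs_def copies_eq edge_orients_def matchings_def incoming_def outgoing_def
        head_def tail_def intro: bij_betw_same_card)
qed

text \<open>The members of \<open>butlast cs\<close> are the entries that have a next one, and their
  heads lie in \<open>V\<close> anyway, so avoiding \<open>a\<close> and \<open>b\<close> means
  lying in \<open>V - {a, b}\<close>.\<close>

lemma pieces_eq_trails:
  assumes G: "finite_graph V E" and \<omega>: "\<omega> \<in> loop_configs V E"
  shows "pieces E a b \<omega> = trails (edge_copies E (mult \<omega>)) (V - {a, b}) (orient \<omega>) (succ \<omega>) a b"
proof -
  have o': "orient \<omega> \<in> edge_orients (edge_copies E (mult \<omega>))" using \<omega> by (simp add: loop_configs_iff[OF G])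
  have "(\<forall>c\<in>set (butlast cs). head \<omega> c \<noteq> a \<and> head \<omega> c \<noteq> b) \<longleftrightarrow>
      (\<forall>i. Suc i < length cs \<longrightarrow> snd (orient \<omega> (cs ! i)) \<in> V - {a, b})"
    if "set cs \<subseteq> edge_copies E (mult \<omega>)" for cs
  proof -
    have "snd (orient \<omega> (cs ! i)) \<in> V" if "Suc i < length cs" for i
      using edge_orientsD(4)[OF G o'] subsetD[OF \<open>set cs \<subseteq> _\<close> nth_mem, of i] that by simp
    moreover have "(\<forall>c\<in>set (butlast cs). P c) \<longleftrightarrow> (\<forall>i. Suc i < length cs \<longrightarrow> P (cs ! i))" for P
      by (simp add: all_set_conv_all_nth nth_butlast less_diff_conv)
    ultimately show ?thesis by (auto simp: head_def)
  qed
  then show ?thesis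
    unfolding pieces_def trails_def copies_eq by (intro Collect_cong) (auto simp: head_def tail_def)
qed

text \<open>A finite exhaustion of the loop configurations, cut off in the same way as the truncated
  XY weight so that the partial sums of both models can be compared.\<close>

definition loop_box :: "'a set \<Rightarrow> 'a set set \<Rightarrow> nat \<Rightarrow> 'a loop_config set" where
  "loop_box V E N = {\<omega> \<in> loop_configs V E. mult \<omega> \<in> mult_box E N}"

lemma
  assumes G: "finite_graph V E"
  shows finite_loop_box: "finite (loop_box V E N)"
    and sum_loop_box: "(\<Sum>\<omega>\<in>loop_box V E N. F (mult \<omega>) (orient \<omega>) (succ \<omega>)) =
      (\<Sum>M\<in>mult_box E N. \<Sum>o'\<in>edge_orients (edge_copies E M).
        \<Sum>s\<in>matchings (edge_copies E M) V o'. (F M o' s :: real))"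
proof -
  note fin = finite_graph_edges[OF G]
  let ?T = "SIGMA M:mult_box E N. SIGMA o':edge_orients (edge_copies E M).
    matchings (edge_copies E M) V o'"
  let ?j = "\<lambda>\<omega>. (mult \<omega>, orient \<omega>, succ \<omega>)"
  let ?i = "\<lambda>(M, o', s). \<lparr>mult = M, orient = o', succ = s\<rparr>"
  have bij: "bij_betw ?j (loop_box V E N) ?T"
    by (rule bij_betw_byWitness[where f' = ?i])
      (auto simp: loop_box_def loop_configs_iff[OF G] mult_box_def)
  have inner: "finite (SIGMA o':edge_orients (edge_copies E M). matchings (edge_copies E M) V o')" for M
    by (intro finite_SigmaI finite_edge_orients[OF G] finite_matchings finite_edge_copies fin)
  have "finite ?T" by (intro finite_SigmaI finite_mult_box fin inner)
  then show "finite (loop_box V E N)" using bij_betw_finite[OF bij] by simp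
  have "(\<Sum>\<omega>\<in>loop_box V E N. F (mult \<omega>) (orient \<omega>) (succ \<omega>)) = (\<Sum>(M, o', s)\<in>?T. F M o' s)"
    using sum.reindex_bij_betw[OF bij, of "\<lambda>(M, o', s). F M o' s"] by simp
  also have "\<dots> = (\<Sum>M\<in>mult_box E N. \<Sum>(o', s)\<in>(SIGMA o':edge_orients (edge_copies E M).
      matchings (edge_copies E M) V o'). F M o' s)"
    by (rule sum.Sigma[symmetric]) (auto intro: finite_mult_box fin inner)
  also have "\<dots> = (\<Sum>M\<in>mult_box E N. \<Sum>o'\<in>edge_orients (edge_copies E M).
      \<Sum>s\<in>matchings (edge_copies E M) V o'. F M o' s)"
    by (intro sum.cong refl sum.Sigma[symmetric])
      (auto intro: finite_edge_orients[OF G] finite_matchings finite_edge_copies fin)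
  finally show "(\<Sum>\<omega>\<in>loop_box V E N. F (mult \<omega>) (orient \<omega>) (succ \<omega>)) = \<dots>" .
qed

lemma loop_weight_eq:
  "loop_weight V E \<beta> \<omega> =
    mult_weight E \<beta> (mult \<omega>) * (\<Prod>v\<in>V. 1 / fact (half_degree E (mult \<omega>) v))"
  by (simp add: loop_weight_def mult_weight_def half_degree_def degree_def)

lemma sum_loop_weight:
  assumes G: "finite_graph V E"
  shows "(\<Sum>\<omega>\<in>loop_box V E N. loop_weight V E \<beta> \<omega>) =
    (\<Sum>M\<in>mult_box E N. mult_weight E \<beta> M *
      real (current_count V (edge_copies E M) (\<lambda>_. 0) (\<lambda>_. 0)))"
  unfolding loop_weight_eq
  by (subst sum_loop_box[OF G, of "\<lambda>M _ _. mult_weight E \<beta> M * (\<Prod>v\<in>V. 1 / fact (half_degree E M v))"])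
    (simp only: sum_distrib_left[symmetric] sum_matchings_current_count[OF G])

lemma sum_loop_weight_pieces:
  assumes G: "finite_graph V E" and ab: "a \<in> V" "b \<in> V" "a \<noteq> b"
  shows "(\<Sum>\<omega>\<in>loop_box V E N. loop_weight V E \<beta> \<omega> *
      (real (num_pieces E a b \<omega>) / (real (num_pieces E a b \<omega>) + 1))) =
    (\<Sum>M\<in>mult_box E N. mult_weight E \<beta> M *
      real (current_count V (edge_copies E M)
        (\<lambda>v. if v = a then 2 else 0) (\<lambda>v. if v = b then 2 else 0)))"
proof -
  let ?k = "\<lambda>M o' s. real (card (trails (edge_copies E M) (V - {a, b}) o' s a b))"
  let ?F = "\<lambda>M o' s. mult_weight E \<beta> M *
    ((\<Prod>v\<in>V. 1 / fact (half_degree E M v)) * (?k M o' s / (?k M o' s + 1)))"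
  have "(\<Sum>\<omega>\<in>loop_box V E N. loop_weight V E \<beta> \<omega> *
      (real (num_pieces E a b \<omega>) / (real (num_pieces E a b \<omega>) + 1))) =
    (\<Sum>\<omega>\<in>loop_box V E N. ?F (mult \<omega>) (orient \<omega>) (succ \<omega>))"
    by (intro sum.cong refl)
      (simp only: loop_box_def mem_Collect_eq loop_weight_eq num_pieces_def pieces_eq_trails[OF G] mult.assoc)
  also have "\<dots> = (\<Sum>M\<in>mult_box E N. mult_weight E \<beta> M *
      real (current_count V (edge_copies E M)
        (\<lambda>v. if v = a then 2 else 0) (\<lambda>v. if v = b then 2 else 0)))"
    unfolding sum_trails_current_count[OF G ab, symmetric]
    by (subst sum_loop_box[OF G, of ?F]) (simp only: sum_distrib_left)
  finally show ?thesis .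
qed

text \<open>The boxes increase to the set of all loop configurations, so monotone convergence turns
  the limit of box sums into the integral.\<close>

lemma has_bochner_integral_loop_configs:
  fixes g :: "'a loop_config \<Rightarrow> real"
  assumes G: "finite_graph V E" and g: "\<And>\<omega>. 0 \<le> g \<omega>"
    and lim: "(\<lambda>N. \<Sum>\<omega>\<in>loop_box V E N. g \<omega>) \<longlonglongrightarrow> x"
  shows "has_bochner_integral (count_space (loop_configs V E)) g x"
proof -
  let ?L = "loop_configs V E"
  \<comment> \<open>This is \<open>g\<close> cut off to the box, written as a combination of
    indicators of singletons so that its integral is a finite sum.\<close>
  let ?f = "\<lambda>N \<omega>. \<Sum>\<eta>\<in>loop_box V E N. indicat_real {\<eta>} \<omega> * g \<eta>"
  have f: "?f N \<omega> = (if \<omega> \<in> loop_box V E N then g \<omega> else 0)" for N \<omega>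
  proof -
    have "indicat_real {\<eta>} \<omega> * g \<eta> = (if \<eta> = \<omega> then g \<eta> else 0)" for \<eta>
      by (auto simp: indicator_def)
    then show ?thesis using finite_loop_box[OF G] by simp
  qed
  have has: "has_bochner_integral (count_space ?L) (?f N) (\<Sum>\<omega>\<in>loop_box V E N. g \<omega>)" for N
  proof (rule has_bochner_integral_sum)
    fix \<eta> assume "\<eta> \<in> loop_box V E N"
    then have "has_bochner_integral (count_space ?L) (indicat_real {\<eta>})
        (measure (count_space ?L) {\<eta>})"
      by (intro has_bochner_integral_real_indicator) (auto simp: loop_box_def)
    then show "has_bochner_integral (count_space ?L) (\<lambda>\<omega>. indicat_real {\<eta>} \<omega> * g \<eta>) (g \<eta>)"
      using has_bochner_integral_mult_left[of "g \<eta>"] \<open>\<eta> \<in> loop_box V E N\<close>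
      by (force simp: loop_box_def)
  qed
  have mono: "loop_box V E N \<subseteq> loop_box V E N'" if "N \<le> N'" for N N'
    using that by (auto simp: loop_box_def mult_box_def intro: less_le_trans)
  have ev: "\<exists>N. \<omega> \<in> loop_box V E N" if "\<omega> \<in> ?L" for \<omega>
  proof -
    \<comment> \<open>The total multiplicity bounds each single one; the successor makes the
      inequality strict.\<close>
    have "\<forall>e\<in>E. mult \<omega> e < Suc (\<Sum>e\<in>E. mult \<omega> e)"
      using finite_graph_edges(2)[OF G] by (auto simp: less_Suc_eq_le intro: member_le_sum)
    then have "\<omega> \<in> loop_box V E (Suc (\<Sum>e\<in>E. mult \<omega> e))"
      using that by (simp add: loop_box_def mult_box_def loop_configs_iff[OF G])
    then show ?thesis ..
  qed
  show ?thesis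
  proof (rule has_bochner_integral_monotone_convergence[where f = ?f])
    show "integrable (count_space ?L) (?f N)" for N
      using has by (rule integrable.intros)
    show "AE \<omega> in count_space ?L. mono (\<lambda>N. ?f N \<omega>)"
      unfolding f using mono g by (intro AE_I2 monoI) auto
    show "AE \<omega> in count_space ?L. (\<lambda>N. ?f N \<omega>) \<longlonglongrightarrow> g \<omega>"
    proof (rule AE_I2)
      fix \<omega> assume "\<omega> \<in> space (count_space ?L)"
      then obtain N where "\<omega> \<in> loop_box V E N" using ev by auto
      then have "?f N' \<omega> = g \<omega>" if "N' \<ge> N" for N' using mono[OF that] by (auto simp: f)
      then show "(\<lambda>N. ?f N \<omega>) \<longlonglongrightarrow> g \<omega>"
        by (intro tendsto_eventually) (auto simp: eventually_sequentially)
    qed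
    show "(\<lambda>N. integral\<^sup>L (count_space ?L) (?f N)) \<longlonglongrightarrow> x"
      using lim has_bochner_integral_integral_eq[OF has] by simp
  qed simp
qed

section \<open>Comparison of the two expectations\<close>

theorem lemma8:
  fixes V :: "'a set" and E :: "'a set set" and \<beta> :: real and a b :: 'a
  assumes "finite_graph V E"
    and "\<beta> > 0"
    and "a \<in> V" and "b \<in> V" and "a \<noteq> b"
  defines "corr \<equiv> xy_expectation V E \<beta> (\<lambda>\<sigma>. (\<sigma> a)\<^sup>2 * (cnj (\<sigma> b))\<^sup>2)"
    and "P \<equiv> loop_measure V E \<beta>"
    and "m \<equiv> num_pieces E a b"
  shows "corr = complex_of_real (\<integral>\<omega>. real (m \<omega>) / (real (m \<omega>) + 1) \<partial>P) \<and>
    1 / 2 * measure P {\<omega> \<in> space P. m \<omega> > 0} \<le> Re corr \<and>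
    Re corr \<le> measure P {\<omega> \<in> space P. m \<omega> > 0}"
proof -
  note G = assms(1) and \<beta> = assms(2) and ab = assms(3-5)
  note finV = finite_graph_edges(1)[OF G] and finE = finite_graph_edges(2)[OF G]
  let ?p = "\<lambda>v. if v = a then 2 else 0 :: nat" and ?q = "\<lambda>v. if v = b then 2 else 0 :: nat"
  let ?f = "\<lambda>\<sigma>. (\<sigma> a)\<^sup>2 * (cnj (\<sigma> b))\<^sup>2"
  \<comment> \<open>The partial sums shared by both models: for suitable exponents they are
    truncated spin integrals as well as box sums over loop configurations.\<close>
  define cur where "cur p q N =
    (\<Sum>M\<in>mult_box E N. mult_weight E \<beta> M * real (current_count V (edge_copies E M) p q))" for p q N
  have cur: "cur p q = (\<lambda>N. \<Sum>M\<in>mult_box E N.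
      mult_weight E \<beta> M * real (current_count V (edge_copies E M) p q))" for p q
    by (simp add: cur_def fun_eq_iff)
  define h where "h \<omega> = real (m \<omega>) / (real (m \<omega>) + 1)" for \<omega>
  have hh: "h = (\<lambda>\<omega>. real (m \<omega>) / (real (m \<omega>) + 1))" by (simp add: fun_eq_iff h_def)
  define Z where "Z = (\<integral>\<sigma>. xy_density E \<beta> \<sigma> \<partial>spin_measure V)"
  define I where "I = (\<integral>\<sigma>. complex_of_real (xy_density E \<beta> \<sigma>) * ?f \<sigma> \<partial>spin_measure V)"
  have mon: "(\<Prod>v\<in>V. \<sigma> v ^ ?p v * cnj (\<sigma> v) ^ ?q v) = ?f \<sigma>" for \<sigma>
  proof -
    have "\<sigma> v ^ ?p v = (if v = a then (\<sigma> a)\<^sup>2 else 1)"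
      "cnj (\<sigma> v) ^ ?q v = (if v = b then (cnj (\<sigma> b))\<^sup>2 else 1)" for v
      by simp_all
    then show ?thesis using finV ab by (simp only: prod.distrib prod.delta if_True)
  qed
  have hasZ: "has_bochner_integral (spin_measure V) (xy_density E \<beta>) Z"
    using xy_monomial_limit(1)[OF G \<beta>, of "\<lambda>_. 0" "\<lambda>_. 0"]
    by (simp add: has_bochner_integral_iff Z_def complex_of_real_integrable_eq)
  have "(\<lambda>N. complex_of_real (cur (\<lambda>_. 0) (\<lambda>_. 0) N)) \<longlonglongrightarrow> complex_of_real Z"
    using xy_monomial_limit(2)[OF G \<beta>, of "\<lambda>_. 0" "\<lambda>_. 0"] by (simp add: cur_def Z_def)
  then have limZ: "cur (\<lambda>_. 0) (\<lambda>_. 0) \<longlonglongrightarrow> Z" by (rule tendsto_of_real_iff[THEN iffD1])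
  have limI: "(\<lambda>N. complex_of_real (cur ?p ?q N)) \<longlonglongrightarrow> I"
    using xy_monomial_limit(2)[OF G \<beta>, of ?p ?q] unfolding mon cur_def I_def .
  \<comment> \<open>The spin integral is a limit of real numbers, hence real.\<close>
  from tendsto_Re[OF this] have limRe: "cur ?p ?q \<longlonglongrightarrow> Re I" by simp
  then have I: "I = complex_of_real (Re I)"
    using LIMSEQ_unique[OF limI tendsto_of_real[OF limRe]] by simp
  have wpos: "mult_weight E \<beta> M \<ge> 0" for M
    unfolding mult_weight_def using \<beta> by (intro prod_nonneg) simp
  \<comment> \<open>The empty multigraph contributes exactly one, which makes the partition function
    positive. It lies in the box as soon as \<open>N \<ge> 1\<close>.\<close>
  have "1 \<le> cur (\<lambda>_. 0) (\<lambda>_. 0) N" if N: "N \<ge> 1" for N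
  proof -
    have "edge_orients (edge_copies E (\<lambda>_. 0)) = {\<lambda>_. undefined}"
      "edge_copies E (\<lambda>_. 0) = {}"
      by (auto simp: edge_orients_def edge_copies_def)
    then have "1 = mult_weight E \<beta> (\<lambda>_. 0) * real (current_count V (edge_copies E (\<lambda>_. 0)) (\<lambda>_. 0) (\<lambda>_. 0))"
      by (simp add: mult_weight_def current_count_def)
    also have "\<dots> \<le> cur (\<lambda>_. 0) (\<lambda>_. 0) N"
      unfolding cur_def using N wpos finite_mult_box[OF finE]
      by (intro member_le_sum) (auto simp: mult_box_def)
    finally show ?thesis .
  qed
  then have "Z \<ge> 1" by (intro LIMSEQ_le_const[OF limZ]) auto
  then have Z: "Z > 0" by simp
  have fm: "?f \<in> borel_measurable (spin_measure V)"
    using borel_measurable_has_bochner_integral[OF integral_spin_monomial[OF finV, of ?p ?q]]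
    unfolding mon .
  have "corr = (\<integral>\<sigma>. xy_density E \<beta> \<sigma> *\<^sub>R ?f \<sigma> \<partial>spin_measure V) /\<^sub>R Z"
    unfolding corr_def xy_expectation_def xy_measure_def
    by (rule integral_normalized_density[OF hasZ _ Z fm]) (simp add: xy_density_def)
  also have "\<dots> = complex_of_real (Re I / Z)"
    using I by (simp add: I_def scaleR_conv_of_real divide_inverse mult.commute)
  finally have corr: "corr = complex_of_real (Re I / Z)" .

  have lw: "0 \<le> loop_weight V E \<beta> \<omega>" for \<omega>
    unfolding loop_weight_eq using wpos by (simp add: prod_nonneg)
  \<comment> \<open>The box sums of the loop weights are the sums converging to the XY partition
    function, so both models have the same normalisation \<open>Z\<close>.\<close>
  have hasW: "has_bochner_integral (count_space (loop_configs V E)) (loop_weight V E \<beta>) Z"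
    by (rule has_bochner_integral_loop_configs[OF G lw])
      (use limZ in \<open>simp only: sum_loop_weight[OF G] cur\<close>)
  have hasH: "has_bochner_integral (count_space (loop_configs V E))
      (\<lambda>\<omega>. loop_weight V E \<beta> \<omega> * h \<omega>) (Re I)"
    by (rule has_bochner_integral_loop_configs[OF G])
      (use limRe lw in \<open>simp_all only: h_def m_def sum_loop_weight_pieces[OF G ab] cur, simp\<close>)
  interpret P: prob_space P
    unfolding P_def loop_measure_def by (rule prob_space_normalized_density[OF hasW lw Z])
  have setsP: "sets P = Pow (loop_configs V E)" and spaceP: "space P = loop_configs V E"
    by (simp_all add: P_def loop_measure_def normalized_def)
  have "(\<integral>\<omega>. h \<omega> \<partial>P) = (\<integral>\<omega>. loop_weight V E \<beta> \<omega> *\<^sub>R h \<omega> \<partial>count_space (loop_configs V E)) /\<^sub>R Z"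
    unfolding P_def loop_measure_def by (rule integral_normalized_density[OF hasW lw Z]) simp
  also have "\<dots> = Re I / Z"
    using has_bochner_integral_integral_eq[OF hasH] by (simp add: divide_inverse mult.commute)
  finally have intH: "(\<integral>\<omega>. h \<omega> \<partial>P) = Re I / Z" .

  let ?A = "{\<omega> \<in> space P. m \<omega> > 0}"
  have A: "?A \<in> sets P" by (auto simp: setsP spaceP)
  have meas: "g \<in> borel_measurable P" for g :: "'a loop_config \<Rightarrow> real"
    by (auto simp: measurable_def setsP spaceP)
  have h01: "0 \<le> h \<omega>" "h \<omega> \<le> 1" for \<omega> by (auto simp: h_def divide_simps)
  have inth: "integrable P h"
    by (rule P.integrable_const_bound[where B = 1]) (use h01 meas in auto)
  have intA: "integrable P (indicat_real ?A)" using A by (simp add: P.emeasure_eq_measure)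
  \<comment> \<open>For \<open>m \<ge> 1\<close> the value \<open>m / (m + 1)\<close> is at least
    \<open>1 / 2\<close>.\<close>
  have "1 / 2 * measure P ?A = (\<integral>\<omega>. 1 / 2 * indicat_real ?A \<omega> \<partial>P)" using A by simp
  also have "\<dots> \<le> (\<integral>\<omega>. h \<omega> \<partial>P)"
    by (intro integral_mono integrable_mult_right intA inth)
      (auto simp: h_def divide_simps split: split_indicator)
  finally have lower: "1 / 2 * measure P ?A \<le> (\<integral>\<omega>. h \<omega> \<partial>P)" .
  \<comment> \<open>\<open>h\<close> is at most one and vanishes where \<open>m = 0\<close>.\<close>
  have "(\<integral>\<omega>. h \<omega> \<partial>P) \<le> (\<integral>\<omega>. indicat_real ?A \<omega> \<partial>P)"
    by (intro integral_mono inth intA) (use h01 in \<open>auto simp: h_def split: split_indicator\<close>)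
  also have "\<dots> = measure P ?A" using A by simp
  finally have upper: "(\<integral>\<omega>. h \<omega> \<partial>P) \<le> measure P ?A" .
  show ?thesis
    using corr lower upper unfolding intH[symmetric] by (simp add: hh)
qed

end
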